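(* For positive integers $i$ and $n$ let $$c^i_n=\left|\{\lambda\in\mathcal{P}(n) : \mathrm{ind}_{1^{n}}(\lambda)=n-i\}\right|.$$ For each fixed $i\ge 1$ the sequence $(c^i_n)_{n\ge i}$ is eventually constant; let $c^i$ denote its eventual value. Then, as formal power series in $x$, $$\sum_{i\ge 1}c^i x^{i-1}=\prod_{m\ge 1}\frac{1}{(1-x^m)^2}.$$
   Context: All Lie algebras are over $\mathbb{C}$. $\mathcal{P}(n)$ is the set of partitions of the positive integer $n$, i.e. finite non-increasing sequences $\lambda=(\lambda_1,\dots,\lambda_m)$ of positive integers with sum $n$. Seaweed algebras: let $a_1|\cdots|a_m$ and $b_1|\cdots|b_t$ be two compositions of $n$ (finite sequences of positive integers with sum $n$), and let $V=\mathbb{C}^n$ with basis $e_1,\dots,e_n$. Put $V_i=\mathrm{span}\{e_1,\dots,e_{a_1+\cdots+a_i}\}$ for $0\le i\le m$ (so $V_0=\{0\}$, $V_m=V$) and $W_j=\mathrm{span}\{e_{b_1+\cdots+b_j+1},\dots,e_n\}$ for $0\le j\le t$ (so $W_0=V$, $W_t=\{0\}$). The seaweed algebra of type $\frac{a_1|\cdots|a_m}{b_1|\cdots|b_t}$ is the Lie subalgebra of $\mathfrak{sl}(n)$ (trace-zero $n\times n$ complex matrices, with the commutator bracket) consisting of those matrices that map each $V_i$ into itself and each $W_j$ into itself. Index: for a finite-dimensional Lie algebra $\mathfrak{g}$, $\mathrm{ind}(\mathfrak{g})=\min_{f\in\mathfrak{g}^*}\dim\ker(B_f)$, where $B_f(x,y)=f([x,y])$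 for $x,y\in\mathfrak{g}$ and $\ker(B_f)=\{x\in\mathfrak{g}: B_f(x,y)=0\text{ for all }y\in\mathfrak{g}\}$. Partition statistic: for $\lambda=(\lambda_1,\dots,\lambda_m)\in\mathcal{P}(n)$, $\mathrm{ind}_{1^{n}}(\lambda)$ denotes the index of the seaweed algebra of type $\frac{\lambda_1|\cdots|\lambda_m}{1|\cdots|1}$, where the bottom composition consists of $n$ ones. *)

theory Defs
  imports
    "HOL-Analysis.Infinite_Products"
    "HOL-Computational_Algebra.Formal_Power_Series"
    "Jordan_Normal_Form.VS_Connect"
begin

hide_type (open) Finite_Cartesian_Product.vec

subsection \<open>Complex Lie algebras and their index\<close>

locale lie_algebra =
  vectorspace "class_ring :: complex ring" L
  for L :: "(complex, 'v) module" (structure) +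
  fixes bracket :: "'v \<Rightarrow> 'v \<Rightarrow> 'v"
  assumes bracket_closed:
      "\<lbrakk>x \<in> carrier L; y \<in> carrier L\<rbrakk> \<Longrightarrow> bracket x y \<in> carrier L"
    and bracket_add_left:
      "\<lbrakk>x \<in> carrier L; y \<in> carrier L; z \<in> carrier L\<rbrakk>
        \<Longrightarrow> bracket (x \<oplus> y) z = bracket x z \<oplus> bracket y z"
    and bracket_add_right:
      "\<lbrakk>x \<in> carrier L; y \<in> carrier L; z \<in> carrier L\<rbrakk>
        \<Longrightarrow> bracket x (y \<oplus> z) = bracket x y \<oplus> bracket x z"
    and bracket_smult_left:
      "\<lbrakk>x \<in> carrier L; y \<in> carrier L\<rbrakk> \<Longrightarrow> bracket (c \<odot> x) y = c \<odot> bracket x y"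
    and bracket_smult_right:
      "\<lbrakk>x \<in> carrier L; y \<in> carrier L\<rbrakk> \<Longrightarrow> bracket x (c \<odot> y) = c \<odot> bracket x y"
    and bracket_self: "x \<in> carrier L \<Longrightarrow> bracket x x = \<zero>"
    and jacobi:
      "\<lbrakk>x \<in> carrier L; y \<in> carrier L; z \<in> carrier L\<rbrakk>
        \<Longrightarrow> bracket x (bracket y z) \<oplus> bracket y (bracket z x) \<oplus> bracket z (bracket x y) = \<zero>"

text \<open>Linear forms are functions on the whole type; only their values on the carrier matter.\<close>

definition linear_forms :: "(complex, 'v) module \<Rightarrow> ('v \<Rightarrow> complex) set" where
  "linear_forms L = {f.
     (\<forall>x\<in>carrier L. \<forall>y\<in>carrier L. f (x \<oplus>\<^bsub>L\<^esub> y) = f x + f y) \<and>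
     (\<forall>c. \<forall>x\<in>carrier L. f (c \<odot>\<^bsub>L\<^esub> x) = c * f x)}"

definition form_kernel ::
    "(complex, 'v) module \<Rightarrow> ('v \<Rightarrow> 'v \<Rightarrow> 'v) \<Rightarrow> ('v \<Rightarrow> complex) \<Rightarrow> 'v set" where
  "form_kernel L bracket f = {x \<in> carrier L. \<forall>y\<in>carrier L. f (bracket x y) = 0}"

text \<open>The infimum of a nonempty set of natural numbers is its minimum; the zero form shows
  that the set is nonempty.\<close>

definition lie_index :: "(complex, 'v) module \<Rightarrow> ('v \<Rightarrow> 'v \<Rightarrow> 'v) \<Rightarrow> nat" where
  "lie_index L bracket =
     (INF f \<in> linear_forms L.
        vectorspace.dim class_ring (L\<lparr>carrier := form_kernel L bracket f\<rparr>))"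

subsection \<open>Seaweed algebras\<close>

definition mat_trace :: "'a::comm_monoid_add mat \<Rightarrow> 'a" where
  "mat_trace A = (\<Sum>i<dim_row A. A $$ (i, i))"

definition commutator :: "'a::ring mat \<Rightarrow> 'a mat \<Rightarrow> 'a mat" where
  "commutator A B = A * B - B * A"

text \<open>Basis vectors are indexed from 0, so \<open>unit_vec n k\<close> is the basis vector
  number \<open>k + 1\<close>.\<close>

definition left_flag :: "nat \<Rightarrow> nat list \<Rightarrow> nat \<Rightarrow> complex vec set" where
  "left_flag n a i = LinearCombinations.module.span class_ring (module_vec TYPE(complex) n)
     (unit_vec n ` {0..<sum_list (take i a)})"

definition right_flag :: "nat \<Rightarrow> nat list \<Rightarrow> nat \<Rightarrow> complex vec set" where
  "right_flag n b j = LinearCombinations.module.span class_ring (module_vec TYPE(complex) n)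
     (unit_vec n ` {sum_list (take j b)..<n})"

definition seaweed_set :: "nat \<Rightarrow> nat list \<Rightarrow> nat list \<Rightarrow> complex mat set" where
  "seaweed_set n a b = {A \<in> carrier_mat n n. mat_trace A = 0 \<and>
     (\<forall>i\<le>length a. \<forall>v\<in>left_flag n a i. A *\<^sub>v v \<in> left_flag n a i) \<and>
     (\<forall>j\<le>length b. \<forall>v\<in>right_flag n b j. A *\<^sub>v v \<in> right_flag n b j)}"

definition seaweed :: "nat \<Rightarrow> nat list \<Rightarrow> nat list \<Rightarrow> (complex, complex mat) module" where
  "seaweed n a b = (module_mat TYPE(complex) n n)\<lparr>carrier := seaweed_set n a b\<rparr>"

subsection \<open>Partitions and the index statistic\<close>

definition integer_partitions :: "nat \<Rightarrow> nat list set" where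
  "integer_partitions n = {p. sorted_wrt (\<ge>) p \<and> (\<forall>k\<in>set p. 0 < k) \<and> sum_list p = n}"

definition ind_ones :: "nat \<Rightarrow> nat list \<Rightarrow> nat" where
  "ind_ones n p = lie_index (seaweed n p (replicate n 1)) commutator"

definition index_count :: "nat \<Rightarrow> nat \<Rightarrow> nat" where
  "index_count i n = card {p \<in> integer_partitions n. int (ind_ones n p) = int n - int i}"

definition eventual_value :: "(nat \<Rightarrow> 'a) \<Rightarrow> 'a" where
  "eventual_value s = (THE c. eventually (\<lambda>n. s n = c) sequentially)"

subsection \<open>Consistency of the definitions\<close>

lemma eventual_valueI:
  assumes "eventually (\<lambda>n. s n = c) sequentially"
  shows "eventual_value s = c"
  unfolding eventual_value_def
proof (rule the_equality)
  show "eventually (\<lambda>n. s n = c) sequentially" by (rule assms)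
next
  fix d assume "eventually (\<lambda>n. s n = d) sequentially"
  with assms have "eventually (\<lambda>n. c = d) sequentially"
    by eventually_elim simp
  then show "d = c" by simp
qed

lemma finite_integer_partitions: "finite (integer_partitions n)"
proof (rule finite_subset)
  show "integer_partitions n \<subseteq> {p. set p \<subseteq> {0..n} \<and> length p \<le> n}"
  proof
    fix p assume p: "p \<in> integer_partitions n"
    then have s: "sum_list p = n" and pos: "\<forall>k\<in>set p. 0 < k"
      by (auto simp: integer_partitions_def)
    have "length p \<le> sum_list p"
      using pos by (induction p) auto
    moreover have "k \<le> n" if "k \<in> set p" for k
      using member_le_sum_list[OF that] s by simp
    ultimately show "p \<in> {p. set p \<subseteq> {0..n} \<and> length p \<le> n}"
      using s by auto
  qed
qed (simp add: finite_lists_length_le)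

lemma mat_trace_mult_comm:
  fixes A B :: "'a::comm_ring_1 mat"
  assumes "A \<in> carrier_mat n n" "B \<in> carrier_mat n n"
  shows "mat_trace (A * B) = mat_trace (B * A)"
proof -
  have "mat_trace (A * B) = (\<Sum>i<n. \<Sum>k<n. A $$ (i,k) * B $$ (k,i))"
    using assms by (auto simp: mat_trace_def scalar_prod_def lessThan_atLeast0 intro!: sum.cong)
  also have "\<dots> = (\<Sum>k<n. \<Sum>i<n. B $$ (k,i) * A $$ (i,k))"
    by (subst sum.swap) (simp add: mult.commute)
  also have "\<dots> = mat_trace (B * A)"
    using assms by (auto simp: mat_trace_def scalar_prod_def lessThan_atLeast0 intro!: sum.cong)
  finally show ?thesis .
qed

lemma span_unit_vecs_closed:
  fixes n :: nat and K :: "nat set"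
  defines "F \<equiv> LinearCombinations.module.span class_ring (module_vec TYPE(complex) n)
     (unit_vec n ` K)"
  shows "F \<subseteq> carrier_vec n" "0\<^sub>v n \<in> F"
    and "\<And>v w. v \<in> F \<Longrightarrow> w \<in> F \<Longrightarrow> v + w \<in> F"
    and "\<And>c v. v \<in> F \<Longrightarrow> c \<cdot>\<^sub>v v \<in> F"
    and "\<And>v w. v \<in> F \<Longrightarrow> w \<in> F \<Longrightarrow> v - w \<in> F"
proof -
  interpret vec_space "TYPE(complex)" n .
  have U: "unit_vec n ` K \<subseteq> carrier_vec n" by auto
  have F: "F = span (unit_vec n ` K)" by (simp add: F_def)
  show sub: "F \<subseteq> carrier_vec n" unfolding F using U by (rule span_is_subset2)
  show "0\<^sub>v n \<in> F" unfolding F using U span_zero by auto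
  show add: "\<And>v w. v \<in> F \<Longrightarrow> w \<in> F \<Longrightarrow> v + w \<in> F"
    unfolding F using U by (rule span_add1)
  show smult: "\<And>c v. v \<in> F \<Longrightarrow> c \<cdot>\<^sub>v v \<in> F"
    unfolding F using U by (rule smult_in_span)
  fix v w assume v: "v \<in> F" and w: "w \<in> F"
  have "v - w = v + (-1) \<cdot>\<^sub>v w" using sub v w by (intro eq_vecI) auto
  then show "v - w \<in> F" using add[OF v smult[OF w]] by simp
qed

lemma seaweed_set_closed:
  fixes n :: nat and a b :: "nat list"
  defines "S \<equiv> seaweed_set n a b"
  shows "S \<subseteq> carrier_mat n n" "0\<^sub>m n n \<in> S"
    and "\<And>A B. A \<in> S \<Longrightarrow> B \<in> S \<Longrightarrow> A + B \<in> S"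
    and "\<And>c A. A \<in> S \<Longrightarrow> c \<cdot>\<^sub>m A \<in> S"
    and "\<And>A B. A \<in> S \<Longrightarrow> B \<in> S \<Longrightarrow> commutator A B \<in> S"
proof -
  note L = span_unit_vecs_closed[where n = n and K = "{0..<sum_list (take i a)}" for i, folded left_flag_def]
  note R = span_unit_vecs_closed[where n = n and K = "{sum_list (take j b)..<n}" for j, folded right_flag_def]
  have Lc: "\<And>i v. v \<in> left_flag n a i \<Longrightarrow> v \<in> carrier_vec n" using L(1) by blast
  have Rc: "\<And>j v. v \<in> right_flag n b j \<Longrightarrow> v \<in> carrier_vec n" using R(1) by blast
  show sub: "S \<subseteq> carrier_mat n n" by (auto simp: S_def seaweed_set_def)
  have zero: "0\<^sub>m n n *\<^sub>v v = 0\<^sub>v n" if "v \<in> carrier_vec n" for v :: "complex vec"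
    using that by (intro eq_vecI) auto
  show "0\<^sub>m n n \<in> S"
    using L(2) R(2) by (auto simp: S_def seaweed_set_def mat_trace_def zero[OF Lc] zero[OF Rc])
  show "A + B \<in> S" if A: "A \<in> S" and B: "B \<in> S" for A B
  proof -
    have c: "A \<in> carrier_mat n n" "B \<in> carrier_mat n n" using A B sub by auto
    have "mat_trace (A + B) = mat_trace A + mat_trace B"
      using c by (auto simp: mat_trace_def sum.distrib)
    with A B c L(3) R(3) show ?thesis
      by (auto simp: S_def seaweed_set_def add_mult_distrib_mat_vec[OF c Lc]
          add_mult_distrib_mat_vec[OF c Rc])
  qed
  show "k \<cdot>\<^sub>m A \<in> S" if A: "A \<in> S" for k A
  proof -
    have c: "A \<in> carrier_mat n n" using A sub by auto
    have "mat_trace (k \<cdot>\<^sub>m A) = k * mat_trace A"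
      using c by (auto simp: mat_trace_def sum_distrib_left)
    moreover have "(k \<cdot>\<^sub>m A) *\<^sub>v v = k \<cdot>\<^sub>v (A *\<^sub>v v)" if "v \<in> carrier_vec n" for v
      using that c by (intro eq_vecI) auto
    ultimately show ?thesis using A c L(4) R(4) Lc Rc
      by (auto simp: S_def seaweed_set_def)
  qed
  show "commutator A B \<in> S" if A: "A \<in> S" and B: "B \<in> S" for A B
  proof -
    have c: "A \<in> carrier_mat n n" "B \<in> carrier_mat n n" using A B sub by auto
    have "mat_trace (commutator A B) = mat_trace (A * B) - mat_trace (B * A)"
      using c by (auto simp: mat_trace_def commutator_def sum_subtractf)
    then have t: "mat_trace (commutator A B) = 0"
      using mat_trace_mult_comm[OF c] by simp
    have v: "commutator A B *\<^sub>v v = A *\<^sub>v (B *\<^sub>v v) - B *\<^sub>v (A *\<^sub>v v)"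
      if "v \<in> carrier_vec n" for v
      using that c assoc_mult_mat_vec[OF c that] assoc_mult_mat_vec[OF c(2,1) that]
      by (simp add: commutator_def minus_mult_distrib_mat_vec[of _ n n])
    show ?thesis using A B c t L(5) R(5)
      by (auto simp: S_def seaweed_set_def v[OF Lc] v[OF Rc])
         (auto simp: commutator_def)
  qed
qed

lemma lie_algebra_seaweed: "lie_algebra (seaweed n a b) commutator"
proof -
  interpret M: matrix_vs n n "TYPE(complex)" .
  note S = seaweed_set_closed[where n = n and a = a and b = b]
  have Sc: "\<And>A. A \<in> seaweed_set n a b \<Longrightarrow> A \<in> carrier_mat n n" using S(1) by blast
  have "VectorSpace.subspace class_ring (seaweed_set n a b) M.V"
    using S by (auto simp: VectorSpace.subspace_def submodule_def matrix_vs_simps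
        intro!: matrix_vs M.module_axioms)
  then have vs: "vectorspace class_ring (seaweed n a b)"
    unfolding seaweed_def by (rule M.subspace_is_vs)
  show ?thesis
  proof (intro lie_algebra.intro vs lie_algebra_axioms.intro; unfold seaweed_def; simp add: matrix_vs_simps S)
    fix x y z assume "x \<in> seaweed_set n a b" "y \<in> seaweed_set n a b" "z \<in> seaweed_set n a b"
    note c = this[THEN Sc]
    have four: "(P + Q) - (R + T) = (P - R) + (Q - T)"
      if "P \<in> carrier_mat n n" "Q \<in> carrier_mat n n" "R \<in> carrier_mat n n" "T \<in> carrier_mat n n"
      for P Q R T :: "complex mat"
      using that by (intro eq_matI) auto
    show "commutator (x + y) z = commutator x z + commutator y z"
      unfolding commutator_def add_mult_distrib_mat[OF c] mult_add_distrib_mat[OF c(3,1,2)]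
      using c by (intro four mult_carrier_mat)
    show "commutator x (y + z) = commutator x y + commutator x z"
      unfolding commutator_def add_mult_distrib_mat[OF c(2,3,1)] mult_add_distrib_mat[OF c]
      using c by (intro four mult_carrier_mat)
    have comm: "commutator u (commutator v w) = (u * v * w - u * w * v) - (v * w * u - w * v * u)"
      if "u \<in> carrier_mat n n" "v \<in> carrier_mat n n" "w \<in> carrier_mat n n"
      for u v w :: "complex mat"
    proof -
      have "u * (v * w - w * v) = u * v * w - u * w * v"
        using that by (simp add: mult_minus_distrib_mat[of _ n n _ n] assoc_mult_mat[of _ n n _ n _ n])
      moreover have "(v * w - w * v) * u = v * w * u - w * v * u"
        using that by (simp add: minus_mult_distrib_mat[of _ n n])
      ultimately show ?thesis by (simp add: commutator_def)
    qed
    have six: "((P - Q) - (R - T)) + ((R - U) - (W - Q)) + ((W - T) - (P - U)) = 0\<^sub>m n n"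
      if "P \<in> carrier_mat n n" "Q \<in> carrier_mat n n" "R \<in> carrier_mat n n"
        "T \<in> carrier_mat n n" "U \<in> carrier_mat n n" "W \<in> carrier_mat n n"
      for P Q R T U W :: "complex mat"
      using that by (intro eq_matI) auto
    show "commutator x (commutator y z) + commutator y (commutator z x)
        + commutator z (commutator x y) = 0\<^sub>m n n"
      unfolding comm[OF c] comm[OF c(2,3,1)] comm[OF c(3,1,2)]
      using c by (intro six mult_carrier_mat)
  next
    fix k x y assume "x \<in> seaweed_set n a b" "y \<in> seaweed_set n a b"
    note c = this[THEN Sc]
    have two: "k \<cdot>\<^sub>m P - k \<cdot>\<^sub>m Q = k \<cdot>\<^sub>m (P - Q)"
      if "P \<in> carrier_mat n n" "Q \<in> carrier_mat n n" for P Q :: "complex mat"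
      using that by (intro eq_matI) (auto simp: right_diff_distrib)
    show "commutator (k \<cdot>\<^sub>m x) y = k \<cdot>\<^sub>m commutator x y"
      unfolding commutator_def mult_smult_assoc_mat[OF c] mult_smult_distrib[OF c(2,1)]
      using c by (intro two mult_carrier_mat)
    show "commutator x (k \<cdot>\<^sub>m y) = k \<cdot>\<^sub>m commutator x y"
      unfolding commutator_def mult_smult_assoc_mat[OF c(2,1)] mult_smult_distrib[OF c]
      using c by (intro two mult_carrier_mat)
  next
    fix x assume "x \<in> seaweed_set n a b"
    note c = this[THEN Sc]
    show "commutator x x = 0\<^sub>m n n"
      using c unfolding commutator_def by auto
  qed
qed

end

theory Submission
  imports
    Defs
    "HOL-Library.Function_Algebras"
    "Jordan_Normal_Form.Spectral_Radius"
begin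

text \<open>
  The bottom composition \<open>1|\<cdots>|1\<close> forces the matrices of the seaweed algebra to be lower
  triangular, and the top composition \<open>\<lambda>\<close> then forces them to be block diagonal. So the algebra
  is the trace-zero part of a direct sum of Borel subalgebras, one in each
  \<open>gl(\<lambda>\<^sub>j)\<close>, and its index is \<open>\<Sum>\<^sub>j \<lceil>\<lambda>\<^sub>j / 2\<rceil> - 1\<close>
  (\<open>ind_ones_eq\<close>). Since \<open>\<lceil>k / 2\<rceil> + \<lfloor>k / 2\<rfloor> = k\<close>, the index
  is \<open>n - i\<close> exactly when \<open>\<Sum>\<^sub>j \<lfloor>\<lambda>\<^sub>j / 2\<rfloor> = i - 1\<close>. Parts equal
  to \<open>1\<close> contribute nothing to this sum, and the other parts add up to at most \<open>3 (i - 1)\<close>; for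
  \<open>n \<ge> 3 (i - 1)\<close> the count therefore no longer depends on \<open>n\<close>. It is the number of partitions
  into parts \<open>\<ge> 2\<close> in which a part \<open>k\<close> weighs \<open>\<lfloor>k / 2\<rfloor>\<close>. The weight \<open>m\<close> is taken by the two
  parts \<open>2 m\<close> and \<open>2 m + 1\<close>, and each of them contributes one factor \<open>1 / (1 - x\<^sup>m)\<close>.

  For the index, write a linear form as \<open>f(y) = tr (\<Phi> y)\<close> with \<open>\<Phi>\<close> block diagonal and upper
  triangular. Then \<open>f([x, y]) = tr ([\<Phi>, x] y)\<close>, so, before the trace condition is imposed, the
  kernel of \<open>B\<^sub>f\<close> consists of the \<open>x\<close> for which \<open>[\<Phi>, x]\<close> vanishes on and above the diagonal of
  each block. The identity lies in this kernel and has nonzero trace, so the trace condition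
  lowers the dimension by exactly one (\<open>dim_form_kernel\<close>). It remains to show that the smallest
  kernel has dimension \<open>\<Sum>\<^sub>j \<lceil>\<lambda>\<^sub>j / 2\<rceil>\<close>, the number of orbits of the map that reverses
  every block.

  \<^item> If \<open>\<Phi>\<close> is the upper half of the antidiagonal of each block, the kernel consists of the
    diagonal matrices that are constant on these orbits (\<open>dim_stabilizer_reversal_form\<close>).

  \<^item> For generic \<open>\<Phi>\<close> there is one kernel element for each orbit. Cut a block into \<open>i\<close>,
    \<open>k - 2 i\<close> and \<open>i\<close> indices and let \<open>C\<close> be the upper right \<open>i \<times> i\<close> corner of \<open>\<Phi>\<close>. If \<open>C\<close> is
    invertible, the projection \<open>x\<close> onto the vectors \<open>v\<close> that are supported on the last \<open>k - i\<close>
    indices and for which \<open>\<Phi> v\<close> vanishes on the first \<open>i\<close> ones, along the span of the last \<open>i\<close>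
    basis vectors and their images under \<open>\<Phi>\<close>, is a kernel element with diagonal \<open>0, 1, 0\<close>
    (\<open>stabilizer_projection\<close>). These diagonals are linearly independent.

  \<^item> An arbitrary \<open>\<Phi>\<close> is the limit, as \<open>t\<close> tends to \<open>0\<close>, of \<open>\<Phi>\<close> plus \<open>t\<close> times the antidiagonal
    form. The corners of the perturbed form are invertible for all but finitely many \<open>t\<close>, because
    the exceptional \<open>t\<close> are negated eigenvalues of the corners, and the dimension of a kernel cannot drop in
    the limit (\<open>kernel_dim_semicontinuous\<close>).
\<close>

section \<open>Spaces of complex functions with finite support\<close>

text \<open>Linear algebra takes place in spaces of functions on a possibly infinite index type, so that
the size of the matrices may vary inside a proof; finite-dimensionality comes from restricting
to functions supported on a finite set.\<close>

definition fscale :: "complex \<Rightarrow> ('i \<Rightarrow> complex) \<Rightarrow> 'i \<Rightarrow> complex" where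
  "fscale c x = (\<lambda>i. c * x i)"

lemma fscale_apply [simp]: "fscale c x i = c * x i"
  by (simp add: fscale_def)

interpretation fs: vector_space fscale
  by standard (auto simp: fun_eq_iff algebra_simps)

interpretation fs2: vector_space_pair
  "fscale :: complex \<Rightarrow> ('i \<Rightarrow> complex) \<Rightarrow> _" "fscale :: complex \<Rightarrow> ('j \<Rightarrow> complex) \<Rightarrow> _"
  by standard

abbreviation flinear :: "(('i \<Rightarrow> complex) \<Rightarrow> 'j \<Rightarrow> complex) \<Rightarrow> bool" where
  "flinear \<equiv> Vector_Spaces.linear fscale fscale"

definition delta :: "'i \<Rightarrow> 'i \<Rightarrow> complex" where
  "delta k = (\<lambda>i. if i = k then 1 else 0)"

definition supported :: "'i set \<Rightarrow> ('i \<Rightarrow> complex) set" where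
  "supported I = {x. \<forall>i. i \<notin> I \<longrightarrow> x i = 0}"

lemma sum_fun_apply: "(\<Sum>k\<in>A. F k) i = (\<Sum>k\<in>A. F k i)" for F :: "'k \<Rightarrow> 'i \<Rightarrow> complex"
  by (induction A rule: infinite_finite_induct) auto

lemma supported_expand:
  assumes "finite I" "x \<in> supported I"
  shows "x = (\<Sum>k\<in>I. fscale (x k) (delta k))"
  using assms by (auto simp: fun_eq_iff sum_fun_apply delta_def supported_def if_distrib cong: if_cong)

lemma supported_span:
  assumes "finite I"
  shows "supported I \<subseteq> fs.span (delta ` I)"
proof
  fix x assume "x \<in> supported I"
  then have "x = (\<Sum>k\<in>I. fscale (x k) (delta k))" by (rule supported_expand[OF assms])
  also have "\<dots> \<in> fs.span (delta ` I)"
    by (intro fs.span_sum fs.span_scale fs.span_base) auto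
  finally show "x \<in> fs.span (delta ` I)" .
qed

lemma independent_supported_finite:
  assumes "finite I" "fs.independent B" "B \<subseteq> supported I"
  shows "finite B"
  using fs.independent_span_bound[of "delta ` I" B] supported_span[OF assms(1)] assms by blast

lemma subspace_supported: "fs.subspace (supported I)"
  by (auto simp: fs.subspace_def supported_def)

lemma obtain_basis:
  assumes "finite I" "V \<subseteq> supported I"
  obtains B where "B \<subseteq> V" "fs.independent B" "V \<subseteq> fs.span B" "finite B" "card B = fs.dim V"
proof -
  obtain B where B: "B \<subseteq> V" "fs.independent B" "V \<subseteq> fs.span B" "card B = fs.dim V"
    using fs.basis_exists by blast
  show thesis
    by (rule that[OF B(1,2,3) _ B(4)]) (use B assms independent_supported_finite in blast)
qed

lemma card_le_dim:
  assumes "finite I" "V \<subseteq> supported I" "fs.independent S" "S \<subseteq> V"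
  shows "card S \<le> fs.dim V"
proof -
  obtain B where B: "V \<subseteq> fs.span B" "finite B" "card B = fs.dim V"
    using obtain_basis[OF assms(1,2)] .
  then show ?thesis using fs.independent_span_bound[of B S] assms by auto
qed

text \<open>The coordinate \<open>d b\<close> for the least index \<open>b\<close> vanishes on all the other vectors,
hence on their span, but not on \<open>x b\<close>. So adding vectors in decreasing order of their index keeps
the family independent.\<close>

lemma triangular_independent:
  fixes x :: "nat \<Rightarrow> 'i \<Rightarrow> complex"
  assumes "finite R"
    and "\<And>r. r \<in> R \<Longrightarrow> x r (d r) \<noteq> 0"
    and "\<And>r q. r \<in> R \<Longrightarrow> q \<in> R \<Longrightarrow> q < r \<Longrightarrow> x r (d q) = 0"
  shows "fs.independent (x ` R) \<and> card (x ` R) = card R"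
  using assms
proof (induction R rule: finite_linorder_min_induct)
  case empty
  show ?case by (simp add: fs.independent_empty del: fscale_apply)
next
  case (insert b A)
  have IH: "fs.independent (x ` A)" "card (x ` A) = card A"
    using insert by (auto simp del: fscale_apply)
  have "fs.span (x ` A) \<subseteq> {y. y (d b) = 0}"
    by (rule fs.span_minimal) (use insert in \<open>auto simp: fs.subspace_def\<close>)
  moreover have "x b (d b) \<noteq> 0" using insert by simp
  ultimately have notin: "x b \<notin> fs.span (x ` A)" by auto
  then have "fs.independent (insert (x b) (x ` A))"
    using IH(1) by (rule fs.independent_insertI)
  moreover have "x b \<notin> x ` A" using notin fs.span_superset[of "x ` A"] by (rule contra_subsetD[rotated])
  moreover have "b \<notin> A" using insert.hyps by auto
  ultimately show ?case using IH(2) insert.hyps(1) by (simp del: fscale_apply)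
qed

lemma dim_hyperplane:
  assumes I: "finite I" and V: "V \<subseteq> supported I" "fs.subspace V"
    and t_add: "\<And>x y. t (x + y) = t x + t y" and t_scale: "\<And>c x. t (fscale c x) = c * (t x :: complex)"
    and e: "e \<in> V" "t e \<noteq> 0"
  shows "fs.dim V = Suc (fs.dim {x \<in> V. t x = 0})"
proof -
  let ?K = "{x \<in> V. t x = 0}"
  have KV: "?K \<subseteq> supported I" using V by auto
  have t0: "t 0 = 0" using t_scale[of 0 0] by simp
  have subK: "fs.subspace ?K"
    using V(2) t0 by (auto simp: fs.subspace_def t_add t_scale)
  obtain B where B: "B \<subseteq> ?K" "fs.independent B" "?K \<subseteq> fs.span B" "finite B" "card B = fs.dim ?K"
    using obtain_basis[OF I KV] .
  have spB: "fs.span B \<subseteq> ?K" using B(1) subK by (rule fs.span_minimal)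
  then have notin: "e \<notin> fs.span B" using e by auto
  have "V \<subseteq> fs.span (insert e B)"
  proof
    fix x assume x: "x \<in> V"
    \<comment> \<open>subtracting this multiple of \<open>e\<close> makes \<open>t\<close> vanish\<close>
    define k where "k = t x / t e"
    have "x - fscale k e \<in> V" using x e V(2) fs.subspace_diff fs.subspace_scale by blast
    moreover have "t (x - fscale k e) = 0"
      using t_add[of "x - fscale k e" "fscale k e"] e by (simp add: t_scale k_def)
    ultimately have "x - fscale k e \<in> fs.span B" using B(3) by auto
    then show "x \<in> fs.span (insert e B)" unfolding fs.span_insert by blast
  qed
  moreover have "fs.independent (insert e B)" using notin B(2) by (rule fs.independent_insertI)
  moreover have "insert e B \<subseteq> V" using e B(1) by auto
  ultimately have "card (insert e B) = fs.dim V" by (intro fs.basis_card_eq_dim)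
  moreover have "e \<notin> B" using notin fs.span_base by blast
  ultimately show ?thesis using B(4,5) by simp
qed

text \<open>Pulling a basis of the image back along the coordinate map gives a basis. This carries
dimensions from the carrier-based vector spaces, in which the index is defined, to spaces of
functions.\<close>

lemma dim_eq_coordinate_dim:
  fixes V :: "(complex, 'v) module" and \<phi> :: "'v \<Rightarrow> 'i \<Rightarrow> complex"
  assumes vs: "vectorspace class_ring V"
    and I: "finite I" and img: "\<phi> ` carrier V \<subseteq> supported I" and inj: "inj_on \<phi> (carrier V)"
    and add: "\<And>x y. x \<in> carrier V \<Longrightarrow> y \<in> carrier V \<Longrightarrow> \<phi> (x \<oplus>\<^bsub>V\<^esub> y) = \<phi> x + \<phi> y"
    and scale: "\<And>c x. x \<in> carrier V \<Longrightarrow> \<phi> (c \<odot>\<^bsub>V\<^esub> x) = fscale c (\<phi> x)"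
  shows "vectorspace.dim class_ring V = fs.dim (\<phi> ` carrier V)"
proof -
  interpret V: vectorspace "class_ring :: complex ring" V by (rule vs)
  obtain B where B: "B \<subseteq> \<phi> ` carrier V" "fs.independent B" "\<phi> ` carrier V \<subseteq> fs.span B"
      "finite B" "card B = fs.dim (\<phi> ` carrier V)"
    using obtain_basis[OF I img] .
  define \<psi> where "\<psi> = inv_into (carrier V) \<phi>"
  have \<psi>: "\<psi> b \<in> carrier V" "\<phi> (\<psi> b) = b" if "b \<in> B" for b
    using that B(1) by (auto simp: \<psi>_def intro: inv_into_into f_inv_into_f)
  define A where "A = \<psi> ` B"
  have A: "finite A" "A \<subseteq> carrier V" using B(4) \<psi> by (auto simp: A_def)
  have \<psi>inj: "inj_on \<psi> B" using \<psi>(2) by (metis inj_onI)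
  have zero: "\<phi> \<zero>\<^bsub>V\<^esub> = 0"
  proof -
    have "\<phi> \<zero>\<^bsub>V\<^esub> + \<phi> \<zero>\<^bsub>V\<^esub> = \<phi> \<zero>\<^bsub>V\<^esub>" using add[of "\<zero>\<^bsub>V\<^esub>" "\<zero>\<^bsub>V\<^esub>"] by simp
    then show ?thesis by simp
  qed
  have lin: "\<phi> (V.lincomb a S) = (\<Sum>v\<in>S. fscale (a v) (\<phi> v))" "V.lincomb a S \<in> carrier V"
    if "finite S" "S \<subseteq> carrier V" for a S
  proof -
    have cl: "a v \<odot>\<^bsub>V\<^esub> v \<in> carrier V" if "v \<in> carrier V" for v
      using that by (intro V.smult_closed) (auto simp: class_ring_simps)
    have "\<phi> (V.lincomb a S) = (\<Sum>v\<in>S. fscale (a v) (\<phi> v)) \<and> V.lincomb a S \<in> carrier V"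
      using that
    proof (induction S rule: finite_induct)
      case empty
      show ?case by (simp add: V.lincomb_def zero)
    next
      case (insert v S)
      have "V.lincomb a (insert v S) = a v \<odot>\<^bsub>V\<^esub> v \<oplus>\<^bsub>V\<^esub> V.lincomb a S"
        unfolding V.lincomb_def using insert cl by (intro V.finsum_insert) auto
      then show ?case using insert cl by (simp add: add scale)
    qed
    then show "\<phi> (V.lincomb a S) = (\<Sum>v\<in>S. fscale (a v) (\<phi> v))" "V.lincomb a S \<in> carrier V"
      by auto
  qed
  have sumA: "(\<Sum>v\<in>A. fscale (a v) (\<phi> v)) = (\<Sum>b\<in>B. fscale (a (\<psi> b)) b)" for a
    unfolding A_def sum.reindex[OF \<psi>inj] comp_def using \<psi>(2) by (intro sum.cong) auto
  have "V.lin_indpt A"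
  proof (rule V.finite_lin_indpt2[OF A])
    fix a assume "V.lincomb a A = \<zero>\<^bsub>V\<^esub>"
    then have "(\<Sum>b\<in>B. fscale (a (\<psi> b)) b) = 0" using lin(1)[OF A, of a] sumA[of a] zero by simp
    then have "\<forall>b\<in>B. a (\<psi> b) = 0"
      using fs.independentD[OF B(2,4) order_refl, of "\<lambda>b. a (\<psi> b)"] by blast
    then show "\<forall>v\<in>A. a v = \<zero>\<^bsub>class_ring\<^esub>" by (simp add: A_def class_ring_simps)
  qed
  moreover have "V.span A = carrier V"
  proof (intro equalityI subsetI)
    fix v assume "v \<in> V.span A"
    then show "v \<in> carrier V" unfolding V.finite_span[OF A] using lin(2)[OF A] by auto
  next
    fix v assume v: "v \<in> carrier V"
    then have "\<phi> v \<in> fs.span B" using B(3) by auto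
    then obtain c where c: "\<phi> v = (\<Sum>b\<in>B. fscale (c b) b)"
      unfolding fs.span_finite[OF B(4)] by auto
    have "\<phi> (V.lincomb (\<lambda>w. c (\<phi> w)) A) = \<phi> v"
      unfolding lin(1)[OF A] sumA c using \<psi>(2) by (intro sum.cong) auto
    then have "v = V.lincomb (\<lambda>w. c (\<phi> w)) A"
      using inj lin(2)[OF A] v by (auto dest: inj_onD)
    then show "v \<in> V.span A"
      unfolding V.finite_span[OF A] by (auto simp: class_ring_simps)
  qed
  ultimately have "V.basis A" using A by (simp add: V.basis_def)
  then have "V.dim = card A" by (rule V.dim_basis[OF A(1)])
  then show ?thesis using B(5) card_image[OF \<psi>inj] by (simp add: A_def)
qed

section \<open>Semicontinuity of the kernel dimension and invertible shifts\<close>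

text \<open>On the finitely supported functions \<open>h\<close> is bounded by some constant \<open>M\<close> in the \<open>1\<close>-norm, so
\<open>t h\<close> is a strict contraction for small \<open>t\<close> and fixes only \<open>0\<close>.\<close>

lemma supported_contraction:
  fixes h :: "('i \<Rightarrow> complex) \<Rightarrow> 'i \<Rightarrow> complex"
  assumes "finite I" "flinear h"
  shows "\<exists>e>0. \<forall>t. norm t < e \<longrightarrow> (\<forall>x\<in>supported I. x = fscale t (h x) \<longrightarrow> x = 0)"
proof -
  define M where "M = (\<Sum>k\<in>I. \<Sum>i\<in>I. norm (h (delta k) i))"
  have M0: "0 \<le> M" unfolding M_def by (intro sum_nonneg) auto
  have "x = 0" if t: "norm t < 1 / (M + 1)" and x: "x \<in> supported I" and eq: "x = fscale t (h x)" for t x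
  proof -
    define N where "N = (\<Sum>i\<in>I. norm (x i))"
    have N0: "0 \<le> N" unfolding N_def by (intro sum_nonneg) auto
    have hx: "h x i = (\<Sum>k\<in>I. x k * h (delta k) i)" for i
    proof -
      have "h x = h (\<Sum>k\<in>I. fscale (x k) (delta k))" using supported_expand[OF assms(1) x] by simp
      also have "\<dots> = (\<Sum>k\<in>I. fscale (x k) (h (delta k)))"
        by (simp add: fs2.linear_sum[OF assms(2)] fs2.linear_scale[OF assms(2)])
      finally show ?thesis by (simp add: sum_fun_apply)
    qed
    have "N = (\<Sum>i\<in>I. norm t * norm (h x i))"
      unfolding N_def by (subst (1) eq) (simp add: norm_mult)
    also have "\<dots> = norm t * (\<Sum>i\<in>I. norm (\<Sum>k\<in>I. x k * h (delta k) i))"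
      unfolding hx sum_distrib_left ..
    also have "\<dots> \<le> norm t * (\<Sum>i\<in>I. \<Sum>k\<in>I. N * norm (h (delta k) i))"
    proof (intro mult_left_mono sum_mono order.trans[OF norm_sum])
      fix i k assume "i \<in> I" "k \<in> I"
      have "norm (x k) \<le> N" unfolding N_def
        using \<open>k \<in> I\<close> assms(1) by (intro member_le_sum) auto
      then show "norm (x k * h (delta k) i) \<le> N * norm (h (delta k) i)"
        by (simp add: norm_mult mult_right_mono)
    qed simp
    also have "\<dots> = norm t * M * N"
      unfolding M_def by (subst sum.swap) (simp add: sum_distrib_left mult_ac)
    finally have le: "N \<le> norm t * M * N" .
    have "norm t * (M + 1) < 1" using t M0 by (simp add: field_simps)
    then have "norm t * M < 1" by (simp add: distrib_left) (use norm_ge_zero[of t] in linarith)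
    then have "\<not> 0 < N" using le mult_strict_right_mono[of "norm t * M" 1 N] by auto
    then have "N = 0" using N0 by simp
    then have "\<forall>i\<in>I. x i = 0" unfolding N_def using assms(1) by (simp add: sum_nonneg_eq_0_iff)
    then show ?thesis using x by (auto simp: supported_def fun_eq_iff)
  qed
  moreover have "0 < 1 / (M + 1)" using M0 by simp
  ultimately show ?thesis by blast
qed

text \<open>A complement \<open>span C\<close> of the kernel of \<open>T0\<close> is mapped injectively by \<open>T0\<close> and so has a
left inverse \<open>g\<close>. A vector \<open>x\<close> of the complement that is killed by \<open>T0 + t T1\<close> satisfies
\<open>x = - t g (T1 x)\<close>, which is impossible for small \<open>t\<close> unless \<open>x = 0\<close>. So, for small \<open>t\<close>, the
projection along the complement embeds the kernel of \<open>T0 + t T1\<close> into the kernel of \<open>T0\<close>.\<close>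

lemma kernel_dim_semicontinuous:
  fixes T0 T1 :: "('i \<Rightarrow> complex) \<Rightarrow> 'j \<Rightarrow> complex"
  assumes I: "finite I" and T0: "flinear T0" and T1: "flinear T1"
  defines "K \<equiv> (\<lambda>t. {x \<in> supported I. T0 x + fscale t (T1 x) = 0})"
  assumes ev: "\<exists>\<^sub>F t in at 0. s \<le> fs.dim (K t)"
  shows "s \<le> fs.dim (K 0)"
proof -
  have sub: "fs.subspace (K t)" for t
  proof -
    have "flinear (\<lambda>x. T0 x + fscale t (T1 x))"
      by (intro fs2.linear_compose_add fs2.linear_compose_scale_right T0 T1)
    then have "fs.subspace {x. T0 x + fscale t (T1 x) = 0}"
      by (rule fs2.linear_subspace_kernel)
    moreover have "K t = supported I \<inter> {x. T0 x + fscale t (T1 x) = 0}"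
      by (auto simp: K_def)
    ultimately show ?thesis by (simp only: fs.subspace_inter[OF subspace_supported])
  qed
  have KV: "K t \<subseteq> supported I" for t by (auto simp: K_def)
  obtain B where B: "B \<subseteq> K 0" "fs.independent B" "K 0 \<subseteq> fs.span B" "finite B" "card B = fs.dim (K 0)"
    using obtain_basis[OF I KV] .
  obtain B' where B': "B \<subseteq> B'" "B' \<subseteq> supported I" "fs.independent B'" "supported I \<subseteq> fs.span B'"
    using fs.maximal_independent_subset_extend[of B "supported I"] B KV by blast
  define C where "C = B' - B"
  \<comment> \<open>the projection onto the kernel of \<open>T0\<close> along the complement\<close>
  obtain p where p: "flinear p" "\<forall>b\<in>B'. p b = (if b \<in> B then b else 0)"
    using fs2.linear_independent_extend[OF B'(3), of "\<lambda>b. if b \<in> B then b else 0"] by blast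
  have pB: "p x = x" if "x \<in> fs.span B" for x
    using fs2.linear_eq_on[OF p(1) fs.linear_id[unfolded id_def] that] p(2) B'(1) by force
  have pC: "p x = 0" if "x \<in> fs.span C" for x
    using fs2.linear_eq_0_on_span[OF p(1) _ that] p(2) by (simp add: C_def)
  have split: "\<exists>b c. b \<in> fs.span B \<and> c \<in> fs.span C \<and> x = b + c" if "x \<in> supported I" for x
  proof -
    have "x \<in> fs.span (B \<union> C)" using that B' by (auto simp: C_def Un_absorb1)
    then show ?thesis unfolding fs.span_Un by auto
  qed
  have CV: "fs.span C \<subseteq> supported I"
    using B'(2) subspace_supported by (intro fs.span_minimal) (auto simp: C_def)
  have "inj_on T0 (fs.span C)"
  proof (subst fs2.linear_inj_on_iff_eq_0[OF T0 fs.subspace_span], intro ballI impI)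
    fix x assume x: "x \<in> fs.span C" "T0 x = 0"
    then have "x \<in> K 0" using CV by (auto simp: K_def fun_eq_iff)
    then show "x = 0" using pB[of x] pC[OF x(1)] B(3) by auto
  qed
  then obtain g where g: "flinear g" "\<forall>x\<in>fs.span C. g (T0 x) = x"
    using fs2.linear_inj_on_left_inverse[OF T0] by blast
  have gT1: "flinear (\<lambda>x. g (T1 x))"
    using Vector_Spaces.linear_compose[OF T1 g(1)] by (simp add: comp_def)
  from supported_contraction[OF I gT1] obtain e where e: "e > 0"
    "\<forall>t. norm t < e \<longrightarrow> (\<forall>x\<in>supported I. x = fscale t (g (T1 x)) \<longrightarrow> x = 0)"
    by (elim exE conjE)
  have "\<forall>\<^sub>F t in at 0. norm (t::complex) < e"
    unfolding eventually_at using e(1) by (auto simp: dist_norm)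
  then have "\<exists>\<^sub>F t in at 0. s \<le> fs.dim (K t) \<and> norm t < e"
    using frequently_eventually_conj[OF ev] by (simp add: conj_commute)
  then obtain t where t: "s \<le> fs.dim (K t)" "norm t < e"
    using frequently_ex by blast
  obtain S where S: "S \<subseteq> K t" "fs.independent S" "K t \<subseteq> fs.span S" "finite S" "card S = fs.dim (K t)"
    using obtain_basis[OF I KV] .
  have spS: "fs.span S \<subseteq> K t" using S(1) sub by (rule fs.span_minimal)
  have inj: "inj_on p (fs.span S)"
  proof (subst fs2.linear_inj_on_iff_eq_0[OF p(1) fs.subspace_span], intro ballI impI)
    fix x assume x: "x \<in> fs.span S" "p x = 0"
    then have xK: "x \<in> K t" using spS by blast
    then have xV: "x \<in> supported I" using KV by blast
    obtain b c where bc: "b \<in> fs.span B" "c \<in> fs.span C" "x = b + c" using split[OF xV] by blast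
    then have "p x = b" using pB pC fs2.linear_add[OF p(1)] by simp
    then have xC: "x \<in> fs.span C" using bc x by simp
    have "T0 x = fscale (- t) (T1 x)"
      using xK by (auto simp: K_def fun_eq_iff eq_neg_iff_add_eq_0)
    then have "x = fscale (- t) (g (T1 x))"
      using bspec[OF g(2) xC] fs2.linear_scale[OF g(1), of "- t" "T1 x"] by simp
    then show "x = 0" using e(2)[rule_format, of "- t" x] t xV by simp
  qed
  then have "fs.independent (p ` S)"
    using fs2.linear_independent_injective_image[OF p(1) S(2)] by blast
  moreover have "p ` S \<subseteq> fs.span B"
  proof
    fix y assume "y \<in> p ` S"
    then obtain x where x: "x \<in> S" "y = p x" by blast
    then have "x \<in> supported I" using S KV by blast
    then obtain b c where bc: "b \<in> fs.span B" "c \<in> fs.span C" "x = b + c" using split by blast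
    then show "y \<in> fs.span B" using x pB pC fs2.linear_add[OF p(1)] by simp
  qed
  ultimately have "card (p ` S) \<le> card B"
    using fs.independent_span_bound[OF B(4)] by blast
  moreover have "card (p ` S) = card S"
    using inj_on_subset[OF inj fs.span_superset] by (rule card_image)
  ultimately show ?thesis using S B t by simp
qed

text \<open>The matrix \<open>c + t I\<close> is singular exactly when \<open>- t\<close> is an eigenvalue of \<open>c\<close>. Invertibility
is stated by a two-sided inverse \<open>D\<close> indexed by the set itself, which is the form in which it is
used.\<close>

lemma finite_noninvertible_shifts:
  fixes c :: "'i \<Rightarrow> 'i \<Rightarrow> complex"
  assumes "finite S"
  shows "finite {t. \<nexists>D. (\<forall>p\<in>S. \<forall>q\<in>S. (\<Sum>a\<in>S. (c p a + (if p = a then t else 0)) * D a q) = (if p = q then 1 else 0))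
    \<and> (\<forall>p\<in>S. \<forall>q\<in>S. (\<Sum>a\<in>S. D p a * (c a q + (if a = q then t else 0))) = (if p = q then 1 else 0))}"
    (is "finite {t. \<nexists>D. ?inv t D}")
proof -
  define m where "m = card S"
  obtain e where e: "bij_betw e {0..<m} S"
    using ex_bij_betw_nat_finite[OF assms] m_def by blast
  define e' where "e' = the_inv_into {0..<m} e"
  have e': "\<And>i. i < m \<Longrightarrow> e' (e i) = i"
    using e by (auto simp: e'_def bij_betw_def intro!: the_inv_into_f_f)
  have einj: "\<And>i j. i < m \<Longrightarrow> j < m \<Longrightarrow> e i = e j \<longleftrightarrow> i = j"
    using e by (auto simp: bij_betw_def inj_on_def)
  have eS: "S = e ` {0..<m}" using e by (auto simp: bij_betw_def)
  define A where "A = mat m m (\<lambda>(i,j). c (e i) (e j))"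
  have A: "A \<in> carrier_mat m m" by (simp add: A_def)
  have "{t. \<nexists>D. ?inv t D} \<subseteq> uminus ` spectrum A"
  proof
    fix t assume "t \<in> {t. \<nexists>D. ?inv t D}"
    then have no: "\<nexists>D. ?inv t D" by simp
    have "\<exists>D. ?inv t D" if ne: "det (char_matrix A (- t)) \<noteq> 0"
    proof -
      let ?M = "char_matrix A (- t)"
      have M: "?M \<in> carrier_mat m m" using A by auto
      have Mix: "?M $$ (i,j) = c (e i) (e j) + (if i = j then t else 0)" if "i < m" "j < m" for i j
        using that by (auto simp: char_matrix_def A_def)
      obtain N where N: "N \<in> carrier_mat m m" "N * ?M = 1\<^sub>m m" "?M * N = 1\<^sub>m m"
        using det_non_zero_imp_unit[OF M ne, of undefined] unfolding Units_def ring_mat_simps by blast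
      define D where "D p q = N $$ (e' p, e' q)" for p q
      have sums: "(\<Sum>a\<in>S. F a) = (\<Sum>k<m. F (e k))" for F :: "'i \<Rightarrow> complex"
        unfolding lessThan_atLeast0 using sum.reindex_bij_betw[OF e, of F] by simp
      have MN: "(\<Sum>k<m. ?M $$ (i,k) * N $$ (k,j)) = (if i = j then 1 else 0)" if "i < m" "j < m" for i j
        using arg_cong[OF N(3), of "\<lambda>X. X $$ (i,j)"] that M N(1)
        by (simp add: scalar_prod_def lessThan_atLeast0)
      have NM: "(\<Sum>k<m. N $$ (i,k) * ?M $$ (k,j)) = (if i = j then 1 else 0)" if "i < m" "j < m" for i j
        using arg_cong[OF N(2), of "\<lambda>X. X $$ (i,j)"] that M N(1)
        by (simp add: scalar_prod_def lessThan_atLeast0)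
      have prods:
        "(\<Sum>k<m. (c (e i) (e k) + (if e i = e k then t else 0)) * D (e k) (e j)) = (if e i = e j then 1 else 0)"
        "(\<Sum>k<m. D (e i) (e k) * (c (e k) (e j) + (if e k = e j then t else 0))) = (if e i = e j then 1 else 0)"
        if "i < m" "j < m" for i j
        using MN[OF that] NM[OF that] that by (simp_all add: D_def e' einj Mix)
      then have "?inv t D"
        unfolding sums unfolding eS ball_simps(9) using prods by simp
      then show ?thesis by blast
    qed
    then have "det (char_matrix A (- t)) = 0" using no by blast
    then have "- t \<in> spectrum A" unfolding spectrum_def eigenvalue_det[OF A] by simp
    then show "t \<in> uminus ` spectrum A" by (rule image_eqI[rotated]) simp
  qed
  then show ?thesis by (rule finite_subset) (intro finite_imageI card_finite_spectrum(1)[OF A])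
qed

section \<open>The stabilizer of the reversal form\<close>

text \<open>The function \<open>blk\<close> names the block of an index, and \<open>rv\<close> is an order-reversing involution of every
block.\<close>

locale block_reversal =
  fixes n :: nat and blk rv :: "nat \<Rightarrow> nat"
  assumes rv_less: "i < n \<Longrightarrow> rv i < n"
    and blk_rv: "i < n \<Longrightarrow> blk (rv i) = blk i"
    and rv_rv: "i < n \<Longrightarrow> rv (rv i) = i"
    and rv_antimono: "i < n \<Longrightarrow> j < n \<Longrightarrow> blk i = blk j \<Longrightarrow> i \<le> j \<Longrightarrow> rv j \<le> rv i"
begin

definition positions :: "(nat \<times> nat) set" where
  "positions = {(i, j). j \<le> i \<and> i < n \<and> blk i = blk j}"

text \<open>The first half of every block, including the middle index of a block of odd size: one
representative of each orbit of \<open>rv\<close>.\<close>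

definition reps :: "nat set" where
  "reps = {r. r < n \<and> r \<le> rv r}"

text \<open>A linear form is given by its coefficients \<open>F\<close>, that is, by the matrix \<open>\<Phi>(j, i) = F (i, j)\<close>.
The value at \<open>(k, j)\<close> is the entry \<open>(j, k)\<close> of \<open>[\<Phi>, x]\<close>, which is the coefficient of \<open>y (k, j)\<close> in
\<open>f([x, y])\<close>.\<close>

definition bracket_coeff :: "(nat \<times> nat \<Rightarrow> complex) \<Rightarrow> (nat \<times> nat \<Rightarrow> complex) \<Rightarrow> nat \<times> nat \<Rightarrow> complex" where
  "bracket_coeff F x = (\<lambda>(k, j). \<Sum>i<n. F (i, j) * x (i, k) - x (j, i) * F (k, i))"

text \<open>The kernel of \<open>B\<^sub>f\<close> on all block lower triangular matrices, without the trace condition.\<close>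

definition stabilizer :: "(nat \<times> nat \<Rightarrow> complex) \<Rightarrow> (nat \<times> nat \<Rightarrow> complex) set" where
  "stabilizer F = {x \<in> supported positions. \<forall>q\<in>positions. bracket_coeff F x q = 0}"

definition reversal_form :: "nat \<times> nat \<Rightarrow> complex" where
  "reversal_form = (\<lambda>(a, b). if a < n \<and> b = rv a \<and> b \<le> a then 1 else 0)"

lemma finite_positions: "finite positions"
  by (rule finite_subset[of _ "{..n} \<times> {..n}"]) (auto simp: positions_def)

lemma finite_reps: "finite reps"
  by (simp add: reps_def)

lemma rv_le_iff: "i < n \<Longrightarrow> j < n \<Longrightarrow> blk i = blk j \<Longrightarrow> rv i \<le> rv j \<longleftrightarrow> j \<le> i"
  using rv_antimono[of j i] rv_antimono[of "rv i" "rv j"] rv_rv rv_less blk_rv by auto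

lemma rv_eq_iff: "i < n \<Longrightarrow> j < n \<Longrightarrow> rv i = j \<longleftrightarrow> i = rv j"
  using rv_rv by auto

text \<open>For this form every row and column of \<open>\<Phi>\<close> has at most one nonzero entry, so
each of the two sums has at most one term.\<close>

lemma bracket_coeff_reversal_form:
  assumes "k < n" "j < n"
  shows "bracket_coeff reversal_form x (k, j) = (if j \<le> rv j then x (rv j, k) else 0) - (if rv k \<le> k then x (j, rv k) else 0)"
proof -
  have "(\<Sum>i<n. reversal_form (i, j) * x (i, k)) = (\<Sum>i<n. if i = rv j then (if j \<le> rv j then x (rv j, k) else 0) else 0)"
  proof (rule sum.cong[OF refl])
    fix i assume "i \<in> {..<n}"
    then have "j = rv i \<longleftrightarrow> i = rv j" using rv_eq_iff[of i j] assms by auto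
    then show "reversal_form (i, j) * x (i, k) = (if i = rv j then (if j \<le> rv j then x (rv j, k) else 0) else 0)"
      using \<open>i \<in> {..<n}\<close> by (simp add: reversal_form_def)
  qed
  moreover have "(\<Sum>i<n. x (j, i) * reversal_form (k, i)) = (\<Sum>i<n. if i = rv k then (if rv k \<le> k then x (j, rv k) else 0) else 0)"
    using assms by (intro sum.cong) (auto simp: reversal_form_def)
  ultimately show ?thesis
    using assms rv_less by (simp add: bracket_coeff_def sum_subtractf sum.delta)
qed

text \<open>An entry below the diagonal is equated by one of the stabilizer equations either with \<open>0\<close> or with
its image under \<open>rv\<close> in both coordinates. That image lies above the diagonal, where \<open>x\<close>
vanishes. The equations at \<open>(rv a, a)\<close> identify the diagonal entries within each orbit.\<close>

lemma stabilizer_reversal_formD: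
  assumes x: "x \<in> stabilizer reversal_form" and ab: "a < n" "b < n"
  shows "a \<noteq> b \<Longrightarrow> x (a, b) = 0" and "x (rv a, rv a) = x (a, a)"
proof -
  have sup: "x (i, j) = 0" if "(i, j) \<notin> positions" for i j
    using x that by (auto simp: stabilizer_def supported_def)
  have eq: "(if j \<le> rv j then x (rv j, k) else 0) = (if rv k \<le> k then x (j, rv k) else 0)"
    if "j \<le> k" "k < n" "blk j = blk k" for j k
    using x that bracket_coeff_reversal_form[of k j x] by (auto simp: stabilizer_def positions_def split: if_splits)
  show "x (a, b) = 0" if ne: "a \<noteq> b"
  proof (cases "(a, b) \<in> positions")
    case True
    then have lt: "b < a" and blk: "blk a = blk b" using ne by (auto simp: positions_def)
    have up: "x (rv a, rv b) = 0"
    proof (rule sup)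
      have "\<not> rv b \<le> rv a" using rv_le_iff[of b a] lt ab blk by simp
      then show "(rv a, rv b) \<notin> positions" by (simp add: positions_def)
    qed
    show ?thesis
    proof (cases "rv a \<le> b")
      case True
      then show ?thesis
        using eq[of "rv a" b] lt ab blk up rv_rv[of a] blk_rv[of a] rv_less[of a] by (auto split: if_splits)
    next
      case False
      then have "a \<le> rv b" using rv_le_iff[of "rv b" a] ab rv_rv blk_rv blk rv_less by auto
      then show ?thesis
        using eq[of a "rv b"] lt ab blk up rv_rv[of b] blk_rv[of b] rv_less[of b] by (auto split: if_splits)
    qed
  qed (simp add: sup)
  have diag: "x (rv c, rv c) = x (c, c)" if "c < n" "c \<le> rv c" for c
    using eq[of c "rv c"] that rv_rv rv_less blk_rv by auto
  show "x (rv a, rv a) = x (a, a)"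
  proof (cases "a \<le> rv a")
    case True
    then show ?thesis using diag ab by simp
  next
    case False
    then show ?thesis using diag[of "rv a"] ab rv_rv rv_less by auto
  qed
qed

lemma dim_stabilizer_reversal_form: "fs.dim (stabilizer reversal_form) \<le> card reps"
proof -
  \<comment> \<open>the diagonal indicator matrix of the orbit of \<open>r\<close>\<close>
  define d where "d r = (\<lambda>(a, b). if a = b \<and> (a = r \<or> a = rv r) then 1 else (0::complex))" for r
  have "stabilizer reversal_form \<subseteq> fs.span (d ` reps)"
  proof
    fix x assume x: "x \<in> stabilizer reversal_form"
    have "x = (\<Sum>r\<in>reps. fscale (x (r, r)) (d r))"
    proof (rule ext, clarify)
      fix a b
      show "x (a, b) = (\<Sum>r\<in>reps. fscale (x (r, r)) (d r)) (a, b)"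
      proof (cases "a = b \<and> a < n")
        case False
        have "x (a, b) = 0"
        proof (cases "a < n \<and> b < n")
          case True
          then show ?thesis using stabilizer_reversal_formD(1)[OF x, of a b] False by auto
        next
          case False
          then show ?thesis using x by (auto simp: stabilizer_def supported_def positions_def)
        qed
        moreover have "d r (a, b) = 0" if "r \<in> reps" for r
          using False that rv_less by (auto simp: d_def reps_def)
        ultimately show ?thesis by (simp add: sum_fun_apply)
      next
        case True
        define r0 where "r0 = (if a \<le> rv a then a else rv a)"
        have r0: "r0 \<in> reps" using True rv_rv rv_less by (auto simp: r0_def reps_def)
        have "d r (a, b) = (if r = r0 then 1 else 0)" if "r \<in> reps" for r
          using True that rv_rv[of a] rv_rv[of r] by (auto simp: d_def r0_def reps_def)
        then have "(\<Sum>r\<in>reps. fscale (x (r, r)) (d r)) (a, b) = (\<Sum>r\<in>reps. if r = r0 then x (r, r) else 0)"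
          by (auto simp: sum_fun_apply intro!: sum.cong)
        also have "\<dots> = x (r0, r0)" using r0 finite_reps by simp
        also have "\<dots> = x (a, b)" using stabilizer_reversal_formD(2)[OF x, of a] True by (auto simp: r0_def)
        finally show ?thesis by simp
      qed
    qed
    also have "\<dots> \<in> fs.span (d ` reps)"
      by (intro fs.span_sum fs.span_scale fs.span_base) auto
    finally show "x \<in> fs.span (d ` reps)" .
  qed
  then have "fs.dim (stabilizer reversal_form) \<le> card (d ` reps)"
    using finite_reps by (intro fs.dim_le_card) auto
  also have "\<dots> \<le> card reps" by (rule card_image_le[OF finite_reps])
  finally show ?thesis .
qed

end

section \<open>A lower bound for the stabilizer of every form\<close>

context block_reversal
begin

text \<open>Let the block of \<open>\<Phi>\<close> have the rows \<open>(A, M, C)\<close>, \<open>(*, E, N)\<close> and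
\<open>(*, *, B)\<close>, so that the hypotheses on \<open>w\<close> and \<open>z\<close> read \<open>M + C w = 0\<close> and \<open>N + z C = 0\<close>. The
element is \<open>x = u v\<close>, where \<open>u\<close> is the column \<open>(0, I, w)\<close> and \<open>v\<close> the row \<open>(z, I, 0)\<close>. Then \<open>\<Phi> u\<close>
vanishes on the first group of indices and \<open>v \<Phi>\<close> on the last one, and on the middle group they
are \<open>E + N w\<close> and \<open>E + z M\<close>, which agree since \<open>N w = - z C w = z M\<close>. Hence \<open>\<Phi> x\<close> and \<open>x \<Phi>\<close>
agree on and above the diagonal.\<close>

lemma stabilizer_projection:
  fixes F :: "nat \<times> nat \<Rightarrow> complex" and w z :: "nat \<Rightarrow> nat \<Rightarrow> complex"
  assumes r: "r \<in> reps"
  defines "I1 \<equiv> {q. q < n \<and> blk q = blk r \<and> q < r}"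
    and "I2 \<equiv> {q. q < n \<and> blk q = blk r \<and> r \<le> q \<and> q \<le> rv r}"
    and "I3 \<equiv> {q. q < n \<and> blk q = blk r \<and> rv r < q}"
  assumes w: "\<And>p m. p \<in> I1 \<Longrightarrow> m \<in> I2 \<Longrightarrow> F (m, p) + (\<Sum>a\<in>I3. F (a, p) * w a m) = 0"
    and z: "\<And>m q. m \<in> I2 \<Longrightarrow> q \<in> I3 \<Longrightarrow> F (q, m) + (\<Sum>b\<in>I1. z m b * F (q, b)) = 0"
  shows "\<exists>x\<in>stabilizer F. \<forall>a<n. x (a, a) = (if a \<in> I2 then 1 else 0)"
proof -
  have rs: "r \<le> rv r" using r by (simp add: reps_def)
  have fin: "finite I1" "finite I2" "finite I3" by (simp_all add: I1_def I2_def I3_def)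
  have disj: "I1 \<inter> I2 = {}" "I2 \<inter> I3 = {}" "I1 \<inter> I3 = {}"
    using rs by (auto simp: I1_def I2_def I3_def)
  have sub: "I1 \<subseteq> {..<n}" "I2 \<subseteq> {..<n}" "I3 \<subseteq> {..<n}"
    by (auto simp: I1_def I2_def I3_def)
  define u where "u a m = (if a = m then 1 else if a \<in> I3 then w a m else 0)" for a m
  define v where "v m b = (if b = m then 1 else if b \<in> I1 then z m b else 0)" for m b
  define x where "x = (\<lambda>(a, b). \<Sum>m\<in>I2. u a m * v m b)"
  \<comment> \<open>the entries of \<open>\<Phi> u\<close> and \<open>v \<Phi>\<close>\<close>
  define S where "S p m = (\<Sum>i<n. F (i, p) * u i m)" for p m
  define T where "T m q = (\<Sum>i<n. v m i * F (q, i))" for m q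
  have S: "S p m = F (m, p) + (\<Sum>a\<in>I3. F (a, p) * w a m)" if m: "m \<in> I2" for p m
  proof -
    have mn: "m < n" "m \<notin> I3" using m sub disj by auto
    have "S p m = (\<Sum>i<n. (if i = m then F (m, p) else 0) + (if i \<in> I3 then F (i, p) * w i m else 0))"
      unfolding S_def using mn by (intro sum.cong) (auto simp: u_def)
    also have "\<dots> = F (m, p) + (\<Sum>i\<in>{..<n} \<inter> I3. F (i, p) * w i m)"
      using mn by (simp add: sum.distrib sum.inter_restrict)
    also have "{..<n} \<inter> I3 = I3" using sub by auto
    finally show ?thesis .
  qed
  have T: "T m q = F (q, m) + (\<Sum>b\<in>I1. z m b * F (q, b))" if m: "m \<in> I2" for m q
  proof -
    have mn: "m < n" "m \<notin> I1" using m sub disj by auto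
    have "T m q = (\<Sum>i<n. (if i = m then F (q, m) else 0) + (if i \<in> I1 then z m i * F (q, i) else 0))"
      unfolding T_def using mn by (intro sum.cong) (auto simp: v_def)
    also have "\<dots> = F (q, m) + (\<Sum>i\<in>{..<n} \<inter> I1. z m i * F (q, i))"
      using mn by (simp add: sum.distrib sum.inter_restrict)
    also have "{..<n} \<inter> I1 = I1" using sub by auto
    finally show ?thesis .
  qed
  have ST: "S p m = T p m" if p: "p \<in> I2" and m: "m \<in> I2" for p m
  proof -
    have "(\<Sum>b\<in>I1. z p b * F (m, b)) = (\<Sum>b\<in>I1. z p b * - (\<Sum>a\<in>I3. F (a, b) * w a m))"
    proof (intro sum.cong refl)
      fix b assume b: "b \<in> I1"
      have "F (m, b) = - (\<Sum>a\<in>I3. F (a, b) * w a m)" using w[OF b m] by (simp add: eq_neg_iff_add_eq_0)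
      then show "z p b * F (m, b) = z p b * - (\<Sum>a\<in>I3. F (a, b) * w a m)" by simp
    qed
    also have "\<dots> = (\<Sum>a\<in>I3. - (\<Sum>b\<in>I1. z p b * F (a, b)) * w a m)"
      unfolding sum_negf[symmetric] sum_distrib_left sum_distrib_right
      by (subst sum.swap) (simp add: mult_ac)
    also have "\<dots> = (\<Sum>a\<in>I3. F (a, p) * w a m)"
    proof (intro sum.cong refl)
      fix a assume a: "a \<in> I3"
      have "F (a, p) = - (\<Sum>b\<in>I1. z p b * F (a, b))" using z[OF p a] by (simp add: eq_neg_iff_add_eq_0)
      then show "- (\<Sum>b\<in>I1. z p b * F (a, b)) * w a m = F (a, p) * w a m" by simp
    qed
    finally show ?thesis unfolding S[OF m] T[OF p] by simp
  qed
  have Fx: "(\<Sum>i<n. F (i, j) * x (i, k)) = (\<Sum>m\<in>I2. S j m * v m k)" for j k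
    unfolding x_def S_def sum_distrib_left sum_distrib_right case_prod_conv
    by (subst sum.swap) (simp add: mult_ac)
  have xF: "(\<Sum>i<n. x (j, i) * F (k, i)) = (\<Sum>m\<in>I2. u j m * T m k)" for j k
    unfolding x_def T_def sum_distrib_left sum_distrib_right case_prod_conv
    by (subst sum.swap) (simp add: mult_ac)
  have u0: "u a m = 0" if "m \<in> I2" "a \<notin> I2" "a \<notin> I3" for a m using that by (auto simp: u_def)
  have v0: "v m b = 0" if "m \<in> I2" "b \<notin> I2" "b \<notin> I1" for b m using that by (auto simp: v_def)
  have u1: "u a m = (if m = a then 1 else 0)" if "a \<in> I2" for a m using that disj by (auto simp: u_def)
  have v1: "v m b = (if m = b then 1 else 0)" if "b \<in> I2" for b m using that disj by (auto simp: v_def)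
  have "bracket_coeff F x (k, j) = 0" if kj: "(k, j) \<in> positions" for k j
  proof -
    have kj': "j \<le> k" "k < n" "j < n" "blk k = blk j" using kj by (auto simp: positions_def)
    have d: "bracket_coeff F x (k, j) = (\<Sum>m\<in>I2. S j m * v m k) - (\<Sum>m\<in>I2. u j m * T m k)"
      unfolding Fx[symmetric] xF[symmetric] by (simp add: bracket_coeff_def sum_subtractf)
    \<comment> \<open>\<open>j \<le> k\<close> excludes the pairs for which the two products differ\<close>
    consider "blk j \<noteq> blk r" | "j \<in> I1" | "k \<in> I3" | "j \<in> I2" "k \<in> I2"
      using kj' rs by (fastforce simp: I1_def I2_def I3_def)
    then show ?thesis
    proof cases
      case 1
      then have "u j m = 0" "v m k = 0" if "m \<in> I2" for m
        using u0[OF that, of j] v0[OF that, of k] kj' by (auto simp: I1_def I2_def I3_def)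
      then show ?thesis unfolding d by simp
    next
      case 2
      then have "u j m = 0" "S j m = 0" if "m \<in> I2" for m
        using u0[OF that, of j] S[OF that] w[OF 2 that] disj by auto
      then show ?thesis unfolding d by simp
    next
      case 3
      then have "v m k = 0" "T m k = 0" if "m \<in> I2" for m
        using v0[OF that, of k] T[OF that] z[OF that 3] disj by auto
      then show ?thesis unfolding d by simp
    next
      case 4
      then show ?thesis unfolding d using fin(2) by (simp add: u1 v1 ST mult_delta_left mult_delta_right)
    qed
  qed
  moreover have "x \<in> supported positions"
  proof -
    have "x (a, b) = 0" if ab: "(a, b) \<notin> positions" for a b
    proof -
      have "u a m * v m b = 0" if m: "m \<in> I2" for m
      proof (rule ccontr)
        assume "u a m * v m b \<noteq> 0"
        then have nz: "u a m \<noteq> 0" "v m b \<noteq> 0" by auto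
        have "a = m \<or> a \<in> I3" using nz(1) by (auto simp: u_def split: if_splits)
        moreover have "b = m \<or> b \<in> I1" using nz(2) by (auto simp: v_def split: if_splits)
        ultimately have "(a, b) \<in> positions" using m rs by (auto simp: positions_def I1_def I2_def I3_def)
        then show False using ab by simp
      qed
      then show ?thesis by (simp add: x_def)
    qed
    then show ?thesis by (auto simp: supported_def)
  qed
  moreover have "x (a, a) = (if a \<in> I2 then 1 else 0)" for a
  proof (cases "a \<in> I2")
    case True
    then show ?thesis using fin(2) by (simp add: x_def u1 v1 mult_delta_left mult_delta_right)
  next
    case False
    have "u a m * v m a = 0" if "m \<in> I2" for m
      using u0[OF that False] v0[OF that False] disj by auto
    then show ?thesis using False by (simp add: x_def)
  qed
  ultimately show ?thesis by (auto simp: stabilizer_def)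
qed

definition before :: "nat \<Rightarrow> nat set" where
  "before r = {q. q < n \<and> blk q = blk r \<and> q < r}"

lemma bij_rv_before:
  assumes "r \<in> reps"
  shows "bij_betw rv (before r) {q. q < n \<and> blk q = blk r \<and> rv r < q}"
proof (rule bij_betwI[where g = rv])
  have r: "r < n" using assms by (simp add: reps_def)
  have less: "rv i < rv j \<longleftrightarrow> j < i" if "i < n" "j < n" "blk i = blk j" for i j
    using rv_le_iff[of j i] that by auto
  show "rv \<in> before r \<rightarrow> {q. q < n \<and> blk q = blk r \<and> rv r < q}"
    using less[of r] r rv_less blk_rv by (auto simp: before_def)
  show "rv \<in> {q. q < n \<and> blk q = blk r \<and> rv r < q} \<rightarrow> before r"
    using less[of _ "rv r"] r rv_less blk_rv rv_rv by (auto simp: before_def)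
qed (use rv_rv in \<open>auto simp: before_def\<close>)

text \<open>The corner of \<open>\<Phi>\<close> that belongs to \<open>r\<close> has the rows \<open>before r\<close> and, in the reversed order, the
columns \<open>rv ` before r\<close>. If it is invertible, \<open>r\<close> contributes a stabilizer element whose diagonal
is the indicator of the interval from \<open>r\<close> to \<open>rv r\<close> in its block. For varying \<open>r\<close> these diagonals
are triangular with respect to the order of the representatives.\<close>

lemma dim_stabilizer_generic:
  assumes inv: "\<And>r. r \<in> reps \<Longrightarrow> \<exists>D. (\<forall>p\<in>before r. \<forall>q\<in>before r.
          (\<Sum>a\<in>before r. F (rv a, p) * D a q) = (if p = q then 1 else 0))
      \<and> (\<forall>p\<in>before r. \<forall>q\<in>before r.
          (\<Sum>a\<in>before r. D p a * F (rv q, a)) = (if p = q then 1 else 0))"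
  shows "card reps \<le> fs.dim (stabilizer F)"
proof -
  have ex: "\<exists>x\<in>stabilizer F. \<forall>a<n. x (a, a) = (if blk a = blk r \<and> r \<le> a \<and> a \<le> rv r then 1 else 0)"
    if r: "r \<in> reps" for r
  proof -
    obtain D where D1: "\<And>p q. p \<in> before r \<Longrightarrow> q \<in> before r \<Longrightarrow>
          (\<Sum>a\<in>before r. F (rv a, p) * D a q) = (if p = q then 1 else 0)"
      and D2: "\<And>p q. p \<in> before r \<Longrightarrow> q \<in> before r \<Longrightarrow>
          (\<Sum>a\<in>before r. D p a * F (rv q, a)) = (if p = q then 1 else 0)"
      using inv[OF r] by blast
    let ?I3 = "{q. q < n \<and> blk q = blk r \<and> rv r < q}"
    note bij = bij_rv_before[OF r]
    have fin: "finite (before r)" by (simp add: before_def)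
    have sgsg: "rv (rv a) = a" if "a \<in> before r" for a using that rv_rv by (simp add: before_def)
    define w where "w a m = - (\<Sum>q\<in>before r. D (rv a) q * F (m, q))" for a m
    define z where "z m b = - (\<Sum>a\<in>before r. F (rv a, m) * D a b)" for m b
    have "\<exists>x\<in>stabilizer F. \<forall>a<n. x (a, a) =
        (if a \<in> {q. q < n \<and> blk q = blk r \<and> r \<le> q \<and> q \<le> rv r} then 1 else 0)"
    proof (rule stabilizer_projection[OF r, folded before_def, where F = F and w = w and z = z])
      fix p m assume p: "p \<in> before r"
      have "(\<Sum>a\<in>?I3. F (a, p) * w a m) = (\<Sum>a\<in>before r. F (rv a, p) * w (rv a) m)"
        by (rule sum.reindex_bij_betw[OF bij, symmetric])
      also have "\<dots> = - (\<Sum>a\<in>before r. \<Sum>q\<in>before r. F (rv a, p) * D a q * F (m, q))"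
        by (simp add: w_def sgsg sum_negf sum_distrib_left mult.assoc)
      also have "\<dots> = - (\<Sum>q\<in>before r. (\<Sum>a\<in>before r. F (rv a, p) * D a q) * F (m, q))"
        by (subst sum.swap) (simp add: sum_distrib_right)
      also have "\<dots> = - F (m, p)" using D1[OF p] p fin by (simp add: mult_delta_left)
      finally show "F (m, p) + (\<Sum>a\<in>?I3. F (a, p) * w a m) = 0" by simp
    next
      fix m q assume q: "q \<in> ?I3"
      then obtain c where c: "c \<in> before r" "q = rv c" using bij by (auto simp: bij_betw_def)
      have "(\<Sum>b\<in>before r. z m b * F (q, b)) = - (\<Sum>b\<in>before r. \<Sum>a\<in>before r. F (rv a, m) * (D a b * F (q, b)))"
        by (simp add: z_def sum_negf sum_distrib_right mult.assoc)
      also have "\<dots> = - (\<Sum>a\<in>before r. F (rv a, m) * (\<Sum>b\<in>before r. D a b * F (rv c, b)))"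
        by (subst sum.swap) (simp add: sum_distrib_left c)
      also have "\<dots> = - (\<Sum>a\<in>before r. F (rv a, m) * (if a = c then 1 else 0))"
        using D2[OF _ c(1)] by (intro arg_cong[of _ _ uminus] sum.cong refl) simp
      also have "\<dots> = - F (q, m)" using c fin by (simp add: mult_delta_right)
      finally show "F (q, m) + (\<Sum>b\<in>before r. z m b * F (q, b)) = 0" by simp
    qed
    then show ?thesis by auto
  qed
  then obtain x where x: "\<And>r. r \<in> reps \<Longrightarrow> x r \<in> stabilizer F"
      "\<And>r a. r \<in> reps \<Longrightarrow> a < n \<Longrightarrow> x r (a, a) = (if blk a = blk r \<and> r \<le> a \<and> a \<le> rv r then 1 else 0)"
    by metis
  have tri: "fs.independent (x ` reps) \<and> card (x ` reps) = card reps"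
    by (rule triangular_independent[of reps x "\<lambda>r. (r, r)"]) (use x(2) in \<open>auto simp: reps_def\<close>)
  have "card (x ` reps) \<le> fs.dim (stabilizer F)"
    by (rule card_le_dim[OF finite_positions]) (use tri x(1) in \<open>auto simp: stabilizer_def\<close>)
  then show ?thesis using tri by simp
qed

text \<open>Adding \<open>t\<close> times the reversal form shifts every corner by \<open>t I\<close>, so all corners become
invertible outside a finite set of values of \<open>t\<close>. Semicontinuity at \<open>t = 0\<close> then carries the generic
bound over.\<close>

lemma dim_stabilizer_lower: "card reps \<le> fs.dim (stabilizer F)"
proof -
  define T where "T H x = (\<lambda>q. if q \<in> positions then bracket_coeff H x q else 0)" for H x
  have lin: "flinear (T H)" for H
    unfolding Vector_Spaces.linear_iff using fs.vector_space_axioms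
    by (auto simp: T_def bracket_coeff_def fun_eq_iff sum.distrib[symmetric] sum_distrib_left algebra_simps
        intro!: sum.cong)
  have K: "{x \<in> supported positions. T F x + fscale t (T reversal_form x) = 0} = stabilizer (F + fscale t reversal_form)" for t
  proof -
    have "bracket_coeff (F + fscale t reversal_form) x q = bracket_coeff F x q + t * bracket_coeff reversal_form x q" for x q
      by (cases q) (simp add: bracket_coeff_def sum.distrib[symmetric] sum_distrib_left algebra_simps)
    then show ?thesis by (auto simp: stabilizer_def T_def fun_eq_iff)
  qed
  \<comment> \<open>the values of \<open>t\<close> for which the corner belonging to \<open>r\<close> is singular\<close>
  define bad where "bad r = {t. \<nexists>D. (\<forall>p\<in>before r. \<forall>q\<in>before r.
        (\<Sum>a\<in>before r. (F (rv a, p) + (if p = a then t else 0)) * D a q) = (if p = q then 1 else 0))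
      \<and> (\<forall>p\<in>before r. \<forall>q\<in>before r.
        (\<Sum>a\<in>before r. D p a * (F (rv q, a) + (if a = q then t else 0))) = (if p = q then 1 else 0))}" for r
  have "finite (bad r)" for r
    unfolding bad_def by (rule finite_noninvertible_shifts) (simp add: before_def)
  then have fin: "finite (\<Union>r\<in>reps. bad r)" using finite_reps by simp
  have good: "card reps \<le> fs.dim (stabilizer (F + fscale t reversal_form))" if t: "t \<notin> (\<Union>r\<in>reps. bad r)" for t
  proof (rule dim_stabilizer_generic)
    fix r assume r: "r \<in> reps"
    have val: "(F + fscale t reversal_form) (rv a, p) = F (rv a, p) + (if p = a then t else 0)"
      if a: "a \<in> before r" and p: "p \<in> before r" for a p
    proof -
      have an: "a < n" "p < n" "blk a = blk r" "a < r" using a p by (auto simp: before_def)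
      have "a \<le> rv a" using an r rv_antimono[of a r] by (auto simp: reps_def)
      then show ?thesis using an rv_less[of a] rv_rv[of a] by (auto simp: reversal_form_def)
    qed
    have "\<exists>D. (\<forall>p\<in>before r. \<forall>q\<in>before r.
        (\<Sum>a\<in>before r. (F (rv a, p) + (if p = a then t else 0)) * D a q) = (if p = q then 1 else 0))
      \<and> (\<forall>p\<in>before r. \<forall>q\<in>before r.
        (\<Sum>a\<in>before r. D p a * (F (rv q, a) + (if a = q then t else 0))) = (if p = q then 1 else 0))"
      using t r unfolding bad_def by blast
    then obtain D where D: "\<forall>p\<in>before r. \<forall>q\<in>before r.
        (\<Sum>a\<in>before r. (F (rv a, p) + (if p = a then t else 0)) * D a q) = (if p = q then 1 else 0)"
      "\<forall>p\<in>before r. \<forall>q\<in>before r.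
        (\<Sum>a\<in>before r. D p a * (F (rv q, a) + (if a = q then t else 0))) = (if p = q then 1 else 0)"
      by (elim exE conjE)
    show "\<exists>D. (\<forall>p\<in>before r. \<forall>q\<in>before r.
        (\<Sum>a\<in>before r. (F + fscale t reversal_form) (rv a, p) * D a q) = (if p = q then 1 else 0))
      \<and> (\<forall>p\<in>before r. \<forall>q\<in>before r.
        (\<Sum>a\<in>before r. D p a * (F + fscale t reversal_form) (rv q, a)) = (if p = q then 1 else 0))"
    proof (intro exI conjI ballI)
      fix p q assume pq: "p \<in> before r" "q \<in> before r"
      show "(\<Sum>a\<in>before r. (F + fscale t reversal_form) (rv a, p) * D a q) = (if p = q then 1 else 0)"
        using D(1)[rule_format, OF pq] pq val by (simp cong: sum.cong del: plus_fun_apply)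
      show "(\<Sum>a\<in>before r. D p a * (F + fscale t reversal_form) (rv q, a)) = (if p = q then 1 else 0)"
        using D(2)[rule_format, OF pq] pq val by (simp cong: sum.cong del: plus_fun_apply)
    qed
  qed
  have "eventually (\<lambda>t. t \<notin> (\<Union>r\<in>reps. bad r)) (at (0::complex))"
    using islimpt_finite[OF fin, of 0] by (auto simp: islimpt_iff_eventually eventually_at_filter elim: eventually_mono)
  then have "eventually (\<lambda>t. card reps \<le> fs.dim (stabilizer (F + fscale t reversal_form))) (at 0)"
    by (rule eventually_mono) (rule good)
  then have freq: "frequently (\<lambda>t. card reps \<le> fs.dim (stabilizer (F + fscale t reversal_form))) (at 0)"
    by (rule eventually_frequently[rotated]) simp
  have "card reps \<le> fs.dim (stabilizer (F + fscale 0 reversal_form))"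
    by (rule kernel_dim_semicontinuous[OF finite_positions lin[of F] lin[of reversal_form], of "card reps", unfolded K, OF freq])
  then show ?thesis by (simp del: fscale_apply)
qed

end

section \<open>The index of a traceless block triangular algebra\<close>

definition entries :: "nat \<Rightarrow> complex mat \<Rightarrow> nat \<times> nat \<Rightarrow> complex" where
  "entries n A = (\<lambda>(i, j). if i < n \<and> j < n then A $$ (i, j) else 0)"

definition trace_fun :: "nat \<Rightarrow> (nat \<times> nat \<Rightarrow> complex) \<Rightarrow> complex" where
  "trace_fun n x = (\<Sum>i<n. x (i, i))"

lemma mat_trace_entries: "A \<in> carrier_mat n n \<Longrightarrow> mat_trace A = trace_fun n (entries n A)"
  by (simp add: mat_trace_def trace_fun_def entries_def)

lemma trace_fun_add: "trace_fun n (x + y) = trace_fun n x + trace_fun n y"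
  by (simp add: trace_fun_def sum.distrib)

lemma trace_fun_scale: "trace_fun n (fscale c x) = c * trace_fun n x"
  by (simp add: trace_fun_def sum_distrib_left)

lemma trace_fun_0: "trace_fun n 0 = 0"
  by (simp add: trace_fun_def)

lemma entries_add:
  "A \<in> carrier_mat n n \<Longrightarrow> B \<in> carrier_mat n n \<Longrightarrow> entries n (A + B) = entries n A + entries n B"
  by (auto simp: entries_def fun_eq_iff)

lemma entries_smult: "A \<in> carrier_mat n n \<Longrightarrow> entries n (c \<cdot>\<^sub>m A) = fscale c (entries n A)"
  by (auto simp: entries_def fun_eq_iff)

lemma entries_mat: "x \<in> supported ({..<n} \<times> {..<n}) \<Longrightarrow> entries n (mat n n x) = x"
  by (auto simp: entries_def supported_def fun_eq_iff)

lemma mat_entries: "A \<in> carrier_mat n n \<Longrightarrow> mat n n (entries n A) = A"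
  by (intro eq_matI) (auto simp: entries_def)

lemma dim_mat_subspace:
  assumes W: "fs.subspace W" "W \<subseteq> supported ({..<n} \<times> {..<n})"
  shows "vectorspace.dim class_ring
    ((module_mat TYPE(complex) n n)\<lparr>carrier := {A \<in> carrier_mat n n. entries n A \<in> W}\<rparr>) = fs.dim W"
proof -
  interpret M: matrix_vs n n "TYPE(complex)" .
  let ?S = "{A \<in> carrier_mat n n. entries n A \<in> W}"
  let ?V = "(module_mat TYPE(complex) n n)\<lparr>carrier := ?S\<rparr>"
  have zero: "entries n (0\<^sub>m n n) = 0" by (auto simp: entries_def fun_eq_iff)
  have cl: "?S \<subseteq> carrier_mat n n" "0\<^sub>m n n \<in> ?S"
    "\<And>A B. A \<in> ?S \<Longrightarrow> B \<in> ?S \<Longrightarrow> A + B \<in> ?S" "\<And>c A. A \<in> ?S \<Longrightarrow> c \<cdot>\<^sub>m A \<in> ?S"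
    using W(1) by (auto simp: entries_add entries_smult zero fs.subspace_def)
  have "VectorSpace.subspace class_ring ?S M.V"
    using cl by (auto simp: VectorSpace.subspace_def submodule_def matrix_vs_simps
        intro!: matrix_vs M.module_axioms)
  then have vs: "vectorspace class_ring ?V" by (rule M.subspace_is_vs)
  have img: "entries n ` ?S = W"
  proof (intro equalityI subsetI)
    fix x assume "x \<in> W"
    then show "x \<in> entries n ` ?S"
      using W(2) entries_mat[of x n] by (intro image_eqI[of _ _ "mat n n x"]) auto
  qed auto
  have "vectorspace.dim class_ring ?V = fs.dim (entries n ` carrier ?V)"
  proof (rule dim_eq_coordinate_dim[OF vs, of "{..<n} \<times> {..<n}"])
    show "inj_on (entries n) (carrier ?V)"
      by (rule inj_on_inverseI[of _ "mat n n"]) (simp add: mat_entries)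
    show "entries n ` carrier ?V \<subseteq> supported ({..<n} \<times> {..<n})"
      using img W(2) by simp
  qed (auto simp: matrix_vs_simps entries_add entries_smult)
  then show ?thesis using img by simp
qed

context block_reversal
begin

definition pairing :: "(nat \<times> nat \<Rightarrow> complex) \<Rightarrow> (nat \<times> nat \<Rightarrow> complex) \<Rightarrow> complex" where
  "pairing F x = (\<Sum>i<n. \<Sum>j<n. F (i, j) * x (i, j))"

definition traceless :: "(nat \<times> nat \<Rightarrow> complex) set" where
  "traceless = {x \<in> supported positions. trace_fun n x = 0}"

text \<open>The matrix units, corrected at \<open>(0, 0)\<close> to have trace zero. The corrected unit at
\<open>(0, 0)\<close> itself is \<open>0\<close>.\<close>

definition traceless_unit :: "nat \<times> nat \<Rightarrow> nat \<times> nat \<Rightarrow> complex" where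
  "traceless_unit q = (if fst q = snd q then delta q - delta (0, 0) else delta q)"

lemma positions_square: "positions \<subseteq> {..<n} \<times> {..<n}"
  by (auto simp: positions_def)

lemma supported_positions_square: "supported positions \<subseteq> supported ({..<n} \<times> {..<n})"
  using positions_square by (auto simp: supported_def)

lemma subspace_traceless: "fs.subspace traceless"
  using subspace_supported[of positions]
  by (auto simp: traceless_def fs.subspace_def trace_fun_add trace_fun_scale trace_fun_0)

lemma traceless_unit_mem: "0 < n \<Longrightarrow> q \<in> positions \<Longrightarrow> traceless_unit q \<in> traceless"
  by (cases q) (auto simp: traceless_def traceless_unit_def supported_def trace_fun_def delta_def positions_def sum_subtractf)

lemma traceless_expand:
  assumes "0 < n" "x \<in> traceless"
  shows "x = (\<Sum>q\<in>positions. fscale (x q) (traceless_unit q))"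
proof -
  have "x \<in> supported positions" using assms(2) by (simp add: traceless_def)
  then have x: "x = (\<Sum>q\<in>positions. fscale (x q) (delta q))" by (rule supported_expand[OF finite_positions])
  have "(\<Sum>q\<in>positions. if fst q = snd q then x q else 0) = (\<Sum>q\<in>(\<lambda>i. (i, i)) ` {..<n}. x q)"
    by (rule sum.mono_neutral_cong_right[OF finite_positions]) (auto simp: positions_def)
  also have "\<dots> = trace_fun n x" unfolding trace_fun_def by (subst sum.reindex) (auto simp: inj_on_def)
  finally have tr: "(\<Sum>q\<in>positions. if fst q = snd q then x q else 0) = 0" using assms(2) by (simp add: traceless_def)
  have "(\<Sum>q\<in>positions. fscale (x q) (traceless_unit q)) =
      (\<Sum>q\<in>positions. fscale (x q) (delta q) - fscale (if fst q = snd q then x q else 0) (delta (0, 0)))"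
    by (intro sum.cong refl) (auto simp: traceless_unit_def fun_eq_iff right_diff_distrib)
  also have "\<dots> = (\<Sum>q\<in>positions. fscale (x q) (delta q)) - fscale (\<Sum>q\<in>positions. if fst q = snd q then x q else 0) (delta (0, 0))"
    unfolding sum_subtractf fs.scale_sum_left ..
  also have "\<dots> = x" unfolding tr x[symmetric] by (simp add: fun_eq_iff)
  finally show ?thesis by simp
qed

lemma pairing_positions:
  assumes "F \<in> supported positions"
  shows "pairing F x = (\<Sum>q\<in>positions. F q * x q)"
proof -
  have "pairing F x = (\<Sum>q\<in>{..<n} \<times> {..<n}. F q * x q)"
    by (simp add: pairing_def sum.cartesian_product case_prod_beta)
  also have "\<dots> = (\<Sum>q\<in>positions. F q * x q)"
    by (rule sum.mono_neutral_right) (use positions_square assms in \<open>auto simp: supported_def\<close>)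
  finally show ?thesis .
qed

lemma pairing_commutator:
  assumes A: "A \<in> carrier_mat n n" and B: "B \<in> carrier_mat n n"
  shows "pairing F (entries n (commutator A B)) =
    (\<Sum>k<n. \<Sum>j<n. entries n B (k, j) * bracket_coeff F (entries n A) (k, j))"
proof -
  let ?a = "entries n A" and ?b = "entries n B"
  have c: "entries n (commutator A B) (i, j) = (\<Sum>k<n. ?a (i, k) * ?b (k, j)) - (\<Sum>k<n. ?b (i, k) * ?a (k, j))"
    if "i < n" "j < n" for i j
    using that A B by (simp add: entries_def commutator_def scalar_prod_def lessThan_atLeast0)
  have "pairing F (entries n (commutator A B)) =
      (\<Sum>i<n. \<Sum>j<n. \<Sum>k<n. F (i, j) * ?a (i, k) * ?b (k, j)) - (\<Sum>i<n. \<Sum>j<n. \<Sum>k<n. F (i, j) * ?b (i, k) * ?a (k, j))"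
    by (simp add: pairing_def c right_diff_distrib sum_subtractf sum_distrib_left mult.assoc)
  also have "(\<Sum>i<n. \<Sum>j<n. \<Sum>k<n. F (i, j) * ?a (i, k) * ?b (k, j)) =
      (\<Sum>k<n. \<Sum>j<n. \<Sum>i<n. F (i, j) * ?a (i, k) * ?b (k, j))"
    by (subst (2) sum.swap, subst sum.swap, subst (2) sum.swap) (rule refl)
  also have "(\<Sum>i<n. \<Sum>j<n. \<Sum>k<n. F (i, j) * ?b (i, k) * ?a (k, j)) =
      (\<Sum>k<n. \<Sum>j<n. \<Sum>i<n. F (k, i) * ?b (k, j) * ?a (j, i))"
    by (subst (2) sum.swap) (rule refl)
  finally show ?thesis
    by (simp add: bracket_coeff_def sum_subtractf sum_distrib_left right_diff_distrib mult_ac)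
qed

text \<open>This is \<open>tr [\<Phi>, x] = 0\<close>.\<close>

lemma bracket_coeff_trace: "(\<Sum>k<n. bracket_coeff F x (k, k)) = 0"
proof -
  have "(\<Sum>k<n. \<Sum>i<n. F (i, k) * x (i, k)) = (\<Sum>k<n. \<Sum>i<n. x (k, i) * F (k, i))"
    by (subst sum.swap) (simp add: mult.commute)
  then show ?thesis by (simp add: bracket_coeff_def sum_subtractf)
qed

text \<open>Testing against the traceless units shows that \<open>[\<Phi>, x]\<close> vanishes above the diagonal of each
block and is constant on the diagonal. Its trace is \<open>0\<close>, so the constant is \<open>0\<close> as well, and
restricting the test matrices to trace zero loses nothing.\<close>

lemma kernel_iff_stabilizer:
  assumes n: "0 < n" and A: "A \<in> carrier_mat n n" "entries n A \<in> traceless"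
  shows "(\<forall>B. B \<in> carrier_mat n n \<and> entries n B \<in> traceless \<longrightarrow> pairing F (entries n (commutator A B)) = 0)
    \<longleftrightarrow> entries n A \<in> stabilizer F"
proof
  assume L: "\<forall>B. B \<in> carrier_mat n n \<and> entries n B \<in> traceless \<longrightarrow> pairing F (entries n (commutator A B)) = 0"
  let ?d = "bracket_coeff F (entries n A)"
  have y: "(\<Sum>k<n. \<Sum>j<n. y (k, j) * ?d (k, j)) = 0" if yG: "y \<in> traceless" for y
  proof -
    have "entries n (mat n n y) = y"
      using yG supported_positions_square by (intro entries_mat) (auto simp: traceless_def)
    then show ?thesis
      using L[rule_format, of "mat n n y"] pairing_commutator[OF A(1), of "mat n n y" F] yG by simp
  qed
  have del: "(\<Sum>k<n. \<Sum>j<n. delta q (k, j) * ?d (k, j)) = ?d q" if q: "q \<in> positions" for q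
  proof -
    have "(\<Sum>k<n. \<Sum>j<n. delta q (k, j) * ?d (k, j)) = (\<Sum>p\<in>{..<n} \<times> {..<n}. delta q p * ?d p)"
      by (simp add: sum.cartesian_product case_prod_beta)
    also have "\<dots> = (\<Sum>p\<in>{..<n} \<times> {..<n}. if p = q then ?d p else 0)"
      by (intro sum.cong) (auto simp: delta_def)
    also have "\<dots> = ?d q" using q positions_square by auto
    finally show ?thesis .
  qed
  have zP: "(0, 0) \<in> positions" using n by (simp add: positions_def)
  have eq: "?d q = (if fst q = snd q then ?d (0, 0) else 0)" if q: "q \<in> positions" for q
  proof (cases "fst q = snd q")
    case True
    have "(\<Sum>k<n. \<Sum>j<n. traceless_unit q (k, j) * ?d (k, j)) = ?d q - ?d (0, 0)"
      unfolding traceless_unit_def if_P[OF True] minus_apply left_diff_distrib sum_subtractf del[OF q] del[OF zP] ..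
    then have "?d q - ?d (0, 0) = 0" unfolding y[OF traceless_unit_mem[OF n q]] by (rule sym)
    then show ?thesis unfolding if_P[OF True] by (rule eq_iff_diff_eq_0[THEN iffD2])
  next
    case False
    have "?d q = 0"
      using y[OF traceless_unit_mem[OF n q]] unfolding traceless_unit_def if_not_P[OF False] del[OF q] .
    then show ?thesis unfolding if_not_P[OF False] .
  qed
  have "(\<Sum>k<n. ?d (k, k)) = (\<Sum>k<n. ?d (0, 0))"
  proof (rule sum.cong[OF refl])
    fix k assume "k \<in> {..<n}"
    then have "(k, k) \<in> positions" by (simp add: positions_def)
    from eq[OF this] show "?d (k, k) = ?d (0, 0)" unfolding fst_conv snd_conv if_P[OF refl] .
  qed
  then have "of_nat n * ?d (0, 0) = 0" unfolding bracket_coeff_trace by simp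
  then have d0: "?d (0, 0) = 0" using n by simp
  have "?d q = 0" if "q \<in> positions" for q using eq[OF that] unfolding d0 if_cancel .
  then have "\<forall>q\<in>positions. ?d q = 0" by blast
  then show "entries n A \<in> stabilizer F" using A(2) by (simp add: stabilizer_def traceless_def)
next
  assume K: "entries n A \<in> stabilizer F"
  show "\<forall>B. B \<in> carrier_mat n n \<and> entries n B \<in> traceless \<longrightarrow> pairing F (entries n (commutator A B)) = 0"
  proof (intro allI impI)
    fix B assume B: "B \<in> carrier_mat n n \<and> entries n B \<in> traceless"
    have "entries n B q * bracket_coeff F (entries n A) q = 0" for q
    proof (cases "q \<in> positions")
      case True
      then show ?thesis using K by (simp add: stabilizer_def)
    next
      case False
      then show ?thesis using B by (cases q) (simp add: traceless_def supported_def)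
    qed
    then show "pairing F (entries n (commutator A B)) = 0"
      using B pairing_commutator[OF A(1)] by simp
  qed
qed

definition block_algebra :: "(complex, complex mat) module" where
  "block_algebra = (module_mat TYPE(complex) n n)\<lparr>carrier := {A \<in> carrier_mat n n. entries n A \<in> traceless}\<rparr>"

text \<open>Off the diagonal the coefficients are the values of \<open>f\<close> at the matrix units. A form on
trace-zero matrices has several extensions to all matrices, and the traceless units select the one
that vanishes at the unit of \<open>(0, 0)\<close>.\<close>

lemma linear_form_pairing:
  assumes n: "0 < n" and f: "f \<in> linear_forms block_algebra"
  shows "\<exists>F. \<forall>x\<in>traceless. f (mat n n x) = pairing F x"
proof -
  have matG: "mat n n x \<in> carrier block_algebra" if "x \<in> traceless" for x
    using that entries_mat[of x n] supported_positions_square by (auto simp: block_algebra_def traceless_def)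
  have add: "f (mat n n (x + y)) = f (mat n n x) + f (mat n n y)" if "x \<in> traceless" "y \<in> traceless" for x y
  proof -
    have "mat n n (x + y) = mat n n x + mat n n y" by (intro eq_matI) auto
    then show ?thesis
      using f matG[OF that(1)] matG[OF that(2)] by (simp add: linear_forms_def block_algebra_def matrix_vs_simps)
  qed
  have scale: "f (mat n n (fscale c x)) = c * f (mat n n x)" if "x \<in> traceless" for x c
  proof -
    have "mat n n (fscale c x) = c \<cdot>\<^sub>m mat n n x" by (intro eq_matI) auto
    then show ?thesis
      using f matG[OF that] by (simp add: linear_forms_def block_algebra_def matrix_vs_simps)
  qed
  have sums: "(\<Sum>q\<in>Q. fscale (c q) (traceless_unit q)) \<in> traceless \<and>
      f (mat n n (\<Sum>q\<in>Q. fscale (c q) (traceless_unit q))) = (\<Sum>q\<in>Q. c q * f (mat n n (traceless_unit q)))"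
    if "finite Q" "Q \<subseteq> positions" for Q c
    using that
  proof (induction Q rule: finite_induct)
    case empty
    have "0 \<in> traceless" using subspace_traceless by (rule fs.subspace_0)
    then show ?case using scale[of 0 0] by (simp add: zero_fun_def fscale_def)
  next
    case (insert q Q)
    have b: "traceless_unit q \<in> traceless" using insert n traceless_unit_mem by auto
    have "fscale (c q) (traceless_unit q) \<in> traceless" using subspace_traceless b by (rule fs.subspace_scale)
    moreover have "(\<Sum>q\<in>Q. fscale (c q) (traceless_unit q)) \<in> traceless" using insert by (simp del: fscale_apply)
    ultimately show ?case
      using insert b fs.subspace_add[OF subspace_traceless] scale[OF b] add by (simp del: fscale_apply plus_fun_apply)
  qed
  define F where "F q = (if q \<in> positions then f (mat n n (traceless_unit q)) else 0)" for q
  have F: "F \<in> supported positions" by (simp add: F_def supported_def)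
  have "f (mat n n x) = pairing F x" if x: "x \<in> traceless" for x
  proof -
    have "f (mat n n x) = f (mat n n (\<Sum>q\<in>positions. fscale (x q) (traceless_unit q)))" using traceless_expand[OF n x] by simp
    also have "\<dots> = (\<Sum>q\<in>positions. x q * f (mat n n (traceless_unit q)))" using sums[OF finite_positions order_refl] by blast
    also have "\<dots> = pairing F x" unfolding pairing_positions[OF F] by (intro sum.cong) (auto simp: F_def)
    finally show ?thesis .
  qed
  then show ?thesis by blast
qed

lemma pairing_linear_form: "(\<lambda>A. pairing F (entries n A)) \<in> linear_forms block_algebra"
proof -
  have "pairing F (x + y) = pairing F x + pairing F y" for x y
    by (simp add: pairing_def distrib_left sum.distrib)
  moreover have "pairing F (fscale c x) = c * pairing F x" for c x
    by (simp add: pairing_def sum_distrib_left mult.left_commute)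
  ultimately show ?thesis
    by (simp add: linear_forms_def block_algebra_def matrix_vs_simps entries_add entries_smult del: fscale_apply)
qed

text \<open>The kernel is the trace-zero hyperplane of the stabilizer, and it is a proper one since the
identity matrix belongs to the stabilizer.\<close>

lemma dim_form_kernel:
  assumes n: "0 < n"
    and f: "\<And>x. x \<in> traceless \<Longrightarrow> f (mat n n x) = pairing F x"
    and closed: "\<And>A B. A \<in> carrier block_algebra \<Longrightarrow> B \<in> carrier block_algebra \<Longrightarrow> commutator A B \<in> carrier block_algebra"
  shows "Suc (vectorspace.dim class_ring (block_algebra\<lparr>carrier := form_kernel block_algebra commutator f\<rparr>)) = fs.dim (stabilizer F)"
proof -
  let ?W = "{x \<in> stabilizer F. trace_fun n x = 0}"
  have sub: "fs.subspace (stabilizer F)"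
    using subspace_supported[of positions]
    by (auto simp: stabilizer_def fs.subspace_def bracket_coeff_def case_prod_beta sum_subtractf distrib_left distrib_right
        sum.distrib sum_distrib_left[symmetric] mult.assoc mult.left_commute)
  have subW: "fs.subspace ?W"
    using sub by (auto simp: fs.subspace_def trace_fun_add trace_fun_scale) (simp add: trace_fun_def)
  have Wsup: "?W \<subseteq> supported ({..<n} \<times> {..<n})"
    using supported_positions_square by (auto simp: stabilizer_def)
  have "form_kernel block_algebra commutator f = {A \<in> carrier_mat n n. entries n A \<in> ?W}" (is "?L = ?reps")
  proof -
    have "A \<in> ?L \<longleftrightarrow> A \<in> ?reps" for A
    proof (cases "A \<in> carrier_mat n n \<and> entries n A \<in> traceless")
      case True
      then have A: "A \<in> carrier_mat n n" "entries n A \<in> traceless" by auto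
      have "f (commutator A B) = pairing F (entries n (commutator A B))"
        if "B \<in> carrier_mat n n" "entries n B \<in> traceless" for B
      proof -
        have "commutator A B \<in> carrier block_algebra" using closed that A by (simp add: block_algebra_def)
        then have "commutator A B \<in> carrier_mat n n" "entries n (commutator A B) \<in> traceless"
          by (simp_all add: block_algebra_def)
        then show ?thesis using f[of "entries n (commutator A B)"] mat_entries by simp
      qed
      then have "A \<in> ?L \<longleftrightarrow> entries n A \<in> stabilizer F"
        unfolding kernel_iff_stabilizer[OF n A, symmetric] using A by (auto simp: form_kernel_def block_algebra_def)
      then show ?thesis using A by (simp add: traceless_def)
    next
      case False
      then show ?thesis by (auto simp: form_kernel_def block_algebra_def traceless_def stabilizer_def)
    qed
    then show ?thesis by blast
  qed
  then have "block_algebra\<lparr>carrier := form_kernel block_algebra commutator f\<rparr> =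
      (module_mat TYPE(complex) n n)\<lparr>carrier := {A \<in> carrier_mat n n. entries n A \<in> ?W}\<rparr>"
    by (simp add: block_algebra_def)
  then have d: "vectorspace.dim class_ring (block_algebra\<lparr>carrier := form_kernel block_algebra commutator f\<rparr>) = fs.dim ?W"
    using dim_mat_subspace[OF subW Wsup] by simp
  \<comment> \<open>the identity matrix\<close>
  define e where "e = (\<lambda>(i, j). if i = j \<and> i < n then 1 else (0::complex))"
  have "bracket_coeff F e q = 0" if "q \<in> positions" for q
  proof -
    obtain k j where q: "q = (k, j)" by (cases q)
    then have kj: "k < n" "j < n" using that by (auto simp: positions_def)
    have "(\<Sum>i<n. F (i, j) * e (i, k)) = (\<Sum>i<n. if i = k then F (i, j) else 0)"
      by (intro sum.cong) (auto simp: e_def)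
    moreover have "(\<Sum>i<n. e (j, i) * F (k, i)) = (\<Sum>i<n. if i = j then F (k, i) else 0)"
      by (intro sum.cong) (auto simp: e_def)
    ultimately show ?thesis using q kj by (simp add: bracket_coeff_def sum_subtractf)
  qed
  then have "e \<in> stabilizer F" by (auto simp: stabilizer_def e_def supported_def positions_def)
  moreover have "trace_fun n e \<noteq> 0" using n by (simp add: trace_fun_def e_def)
  ultimately have "fs.dim (stabilizer F) = Suc (fs.dim ?W)"
    by (intro dim_hyperplane[OF finite_positions _ sub, of "trace_fun n" e])
       (auto simp: stabilizer_def trace_fun_add trace_fun_scale)
  then show ?thesis using d by simp
qed

theorem lie_index_block_algebra:
  assumes n: "0 < n"
    and closed: "\<And>A B. A \<in> carrier block_algebra \<Longrightarrow> B \<in> carrier block_algebra \<Longrightarrow> commutator A B \<in> carrier block_algebra"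
  shows "lie_index block_algebra commutator = card reps - 1"
proof -
  let ?dim = "\<lambda>f. vectorspace.dim class_ring (block_algebra\<lparr>carrier := form_kernel block_algebra commutator f\<rparr>)"
  let ?f = "\<lambda>A. pairing reversal_form (entries n A)"
  have lower: "card reps - 1 \<le> ?dim f" if f: "f \<in> linear_forms block_algebra" for f
  proof -
    obtain F where F: "\<forall>x\<in>traceless. f (mat n n x) = pairing F x"
      using linear_form_pairing[OF n f] by blast
    have "Suc (?dim f) = fs.dim (stabilizer F)"
      by (rule dim_form_kernel[OF n _ closed]) (use F in auto)
    then show ?thesis using dim_stabilizer_lower[of F] by simp
  qed
  have "Suc (?dim ?f) = fs.dim (stabilizer reversal_form)"
  proof (rule dim_form_kernel[OF n _ closed])
    fix x assume "x \<in> traceless"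
    then have "entries n (mat n n x) = x"
      using supported_positions_square by (intro entries_mat) (auto simp: traceless_def)
    then show "pairing reversal_form (entries n (mat n n x)) = pairing reversal_form x" by simp
  qed
  then have "?dim ?f \<le> card reps - 1" using dim_stabilizer_reversal_form by simp
  then have eq: "?dim ?f = card reps - 1" using lower[OF pairing_linear_form] by (rule antisym)
  have "card reps - 1 \<in> ?dim ` linear_forms block_algebra"
    using pairing_linear_form by (intro image_eqI[of _ _ ?f]) (simp_all add: eq)
  then show ?thesis unfolding lie_index_def
    using lower by (intro cInf_eq_minimum) auto
qed

end

section \<open>The blocks of a composition and invariant coordinate subspaces\<close>

fun block_of :: "nat list \<Rightarrow> nat \<Rightarrow> nat" where
  "block_of [] q = 0"
| "block_of (k # ks) q = (if q < k then 0 else Suc (block_of ks (q - k)))"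

fun block_rev :: "nat list \<Rightarrow> nat \<Rightarrow> nat" where
  "block_rev [] q = q"
| "block_rev (k # ks) q = (if q < k then k - 1 - q else k + block_rev ks (q - k))"

lemma block_rev_less: "i < sum_list ks \<Longrightarrow> block_rev ks i < sum_list ks"
proof (induction ks arbitrary: i)
  case (Cons k ks)
  then show ?case using Cons.IH[of "i - k"] by auto
qed simp

lemma block_of_block_rev: "i < sum_list ks \<Longrightarrow> block_of ks (block_rev ks i) = block_of ks i"
  by (induction ks arbitrary: i) auto

lemma block_rev_block_rev: "i < sum_list ks \<Longrightarrow> block_rev ks (block_rev ks i) = i"
  by (induction ks arbitrary: i) auto

lemma block_rev_antimono:
  "i \<le> j \<Longrightarrow> block_of ks i = block_of ks j \<Longrightarrow> j < sum_list ks \<Longrightarrow> block_rev ks j \<le> block_rev ks i"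
proof (induction ks arbitrary: i j)
  case (Cons k ks)
  then show ?case using Cons.IH[of "i - k" "j - k"] by (auto split: if_splits)
qed simp

lemma card_block_rev_orbits:
  "card {r. r < sum_list ks \<and> r \<le> block_rev ks r} = (\<Sum>k\<leftarrow>ks. (k + 1) div 2)"
proof (induction ks)
  case (Cons k ks)
  let ?S = "{r. r < sum_list ks \<and> r \<le> block_rev ks r}"
  have "{r. r < sum_list (k # ks) \<and> r \<le> block_rev (k # ks) r} = {..<(k + 1) div 2} \<union> (\<lambda>r. r + k) ` ?S"
    (is "?L = ?R")
  proof (intro equalityI subsetI)
    fix r assume r: "r \<in> ?L"
    show "r \<in> ?R"
    proof (cases "r < k")
      case False
      then have "r = (r - k) + k" "r - k \<in> ?S" using r by auto
      then show ?thesis by blast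
    qed (use r in auto)
  next
    fix r assume "r \<in> ?R"
    then show "r \<in> ?L" by auto
  qed
  moreover have "{..<(k + 1) div 2} \<inter> (\<lambda>r. r + k) ` ?S = {}" by auto
  ultimately show ?case
    using Cons by (simp add: card_Un_disjoint card_image)
qed simp

text \<open>Two indices lie in different blocks exactly when some partial sum of the composition separates
them; the partial sums are the dimensions of the left flag.\<close>

lemma block_of_eq_iff:
  "b \<le> a \<Longrightarrow> a < sum_list ks \<Longrightarrow>
    block_of ks a = block_of ks b \<longleftrightarrow> (\<forall>i\<le>length ks. \<not> (b < sum_list (take i ks) \<and> sum_list (take i ks) \<le> a))"
proof (induction ks arbitrary: a b)
  case (Cons k ks)
  have split: "(\<forall>i\<le>length (k # ks). Q i) \<longleftrightarrow> Q 0 \<and> (\<forall>i\<le>length ks. Q (Suc i))" for Q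
    by (metis Suc_le_mono bot_nat_0.extremum length_Cons not0_implies_Suc)
  consider "a < k" | "b < k" "k \<le> a" | "k \<le> b" by linarith
  then show ?case
  proof cases
    case 1
    then show ?thesis using Cons.prems unfolding split by auto
  next
    case 2
    then show ?thesis unfolding split by (auto intro!: exI[of _ 0])
  next
    case 3
    then have "k + s \<le> a \<longleftrightarrow> s \<le> a - k" "b < k + s \<longleftrightarrow> b - k < s" for s
      using Cons.prems by auto
    then show ?thesis using 3 Cons.IH[of "b - k" "a - k"] Cons.prems unfolding split by simp
  qed
qed simp

text \<open>The case of unit vectors \<open>unit_vec n k\<close> with \<open>n \<le> k\<close> is harmless: they are zero.\<close>

lemma span_unit_vecs_iff:
  assumes "finite K"
  shows "v \<in> LinearCombinations.module.span class_ring (module_vec TYPE(complex) n) (unit_vec n ` K)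
    \<longleftrightarrow> v \<in> carrier_vec n \<and> (\<forall>r<n. r \<notin> K \<longrightarrow> v $ r = 0)"
proof -
  interpret vec_space "TYPE(complex)" n .
  have U: "unit_vec n ` K \<subseteq> carrier_vec n" for K by auto
  have "v \<in> carrier_vec n \<and> (\<forall>r<n. r \<notin> K \<longrightarrow> v $ r = 0)" if vK: "v \<in> span (unit_vec n ` K)" for v
  proof -
    have fin: "finite (unit_vec n ` K)" using assms by simp
    obtain a where v: "v = lincomb a (unit_vec n ` K)"
      using vK unfolding finite_span[OF fin U] by auto
    have "v $ r = 0" if r: "r < n" "r \<notin> K" for r
      unfolding v lincomb_index[OF r(1) U] using r by (intro sum.neutral) (auto simp: unit_vec_def)
    then show ?thesis using span_is_subset2[OF U] vK by blast
  qed
  moreover have "v \<in> span (unit_vec n ` K)" if "v \<in> carrier_vec n" "\<forall>r<n. r \<notin> K \<longrightarrow> v $ r = 0" for v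
    using assms that
  proof (induction K arbitrary: v rule: finite_induct)
    case empty
    then have "v = 0\<^sub>v n" by (intro eq_vecI) auto
    then show ?case using span_unit_vecs_closed(2)[where n = n and K = "{}"] by simp
  next
    case (insert k K)
    note closed = span_unit_vecs_closed[where n = n and K = "insert k K"]
    define w where "w = vec n (\<lambda>r. if r = k then 0 else v $ r)"
    have "w \<in> span (unit_vec n ` K)"
      by (rule insert.IH) (use insert.prems in \<open>auto simp: w_def\<close>)
    moreover have "span (unit_vec n ` K) \<subseteq> span (unit_vec n ` insert k K)"
      by (rule span_is_monotone) auto
    ultimately have w: "w \<in> span (unit_vec n ` insert k K)" by blast
    show ?case
    proof (cases "k < n")
      case True
      have "unit_vec n k \<in> span (unit_vec n ` insert k K)"
        using in_own_span[OF U] by blast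
      then have "w + v $ k \<cdot>\<^sub>v unit_vec n k \<in> span (unit_vec n ` insert k K)"
        by (intro closed(3) closed(4) w)
      moreover have "w + v $ k \<cdot>\<^sub>v unit_vec n k = v"
        using insert.prems True by (intro eq_vecI) (auto simp: w_def unit_vec_def)
      ultimately show ?thesis by simp
    next
      case False
      then have "w = v" using insert.prems by (intro eq_vecI) (auto simp: w_def)
      then show ?thesis using w by simp
    qed
  qed
  ultimately show ?thesis by blast
qed

lemma preserves_coordinate_span_iff:
  fixes A :: "complex mat"
  assumes A: "A \<in> carrier_mat n n" and K: "finite K"
  defines "U \<equiv> LinearCombinations.module.span class_ring (module_vec TYPE(complex) n) (unit_vec n ` K)"
  shows "(\<forall>v\<in>U. A *\<^sub>v v \<in> U) \<longleftrightarrow> (\<forall>a<n. \<forall>b<n. b \<in> K \<longrightarrow> a \<notin> K \<longrightarrow> A $$ (a, b) = 0)"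
proof
  assume L: "\<forall>v\<in>U. A *\<^sub>v v \<in> U"
  show "\<forall>a<n. \<forall>b<n. b \<in> K \<longrightarrow> a \<notin> K \<longrightarrow> A $$ (a, b) = 0"
  proof (intro allI impI)
    fix a b assume ab: "a < n" "b < n" "b \<in> K" "a \<notin> K"
    have "unit_vec n b \<in> U" unfolding U_def span_unit_vecs_iff[OF K] using ab by auto
    then have "A *\<^sub>v unit_vec n b \<in> U" using L by blast
    then have "(A *\<^sub>v unit_vec n b) $ a = 0" unfolding U_def span_unit_vecs_iff[OF K] using ab by blast
    then show "A $$ (a, b) = 0" using A ab by simp
  qed
next
  assume R: "\<forall>a<n. \<forall>b<n. b \<in> K \<longrightarrow> a \<notin> K \<longrightarrow> A $$ (a, b) = 0"
  show "\<forall>v\<in>U. A *\<^sub>v v \<in> U"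
  proof
    fix v assume "v \<in> U"
    then have v: "v \<in> carrier_vec n" "\<And>r. r < n \<Longrightarrow> r \<notin> K \<Longrightarrow> v $ r = 0"
      unfolding U_def span_unit_vecs_iff[OF K] by auto
    have "(A *\<^sub>v v) $ a = 0" if a: "a < n" "a \<notin> K" for a
    proof -
      have "A $$ (a, b) * v $ b = 0" if "b < n" for b
        using R a v(2) that by (cases "b \<in> K") auto
      then show ?thesis using A v(1) a by (auto simp: scalar_prod_def intro!: sum.neutral)
    qed
    then show "A *\<^sub>v v \<in> U" unfolding U_def span_unit_vecs_iff[OF K] using A v by auto
  qed
qed

section \<open>The index of the seaweed algebra\<close>

lemma block_reversal_list: "block_reversal (sum_list ks) (block_of ks) (block_rev ks)"
  by standard
    (simp_all add: block_rev_less block_of_block_rev block_rev_block_rev block_rev_antimono)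

lemma preserves_right_flags_iff:
  assumes A: "A \<in> carrier_mat n n"
  shows "(\<forall>j\<le>length (replicate n (1::nat)). \<forall>v\<in>right_flag n (replicate n 1) j. A *\<^sub>v v \<in> right_flag n (replicate n 1) j)
    \<longleftrightarrow> (\<forall>a<n. \<forall>b<n. a < b \<longrightarrow> A $$ (a, b) = 0)"
proof -
  have "(\<forall>v\<in>right_flag n (replicate n 1) j. A *\<^sub>v v \<in> right_flag n (replicate n 1) j)
      \<longleftrightarrow> (\<forall>a<n. \<forall>b<n. j \<le> b \<longrightarrow> a < j \<longrightarrow> A $$ (a, b) = 0)" if "j \<le> n" for j
    unfolding right_flag_def preserves_coordinate_span_iff[OF A finite_atLeastLessThan]
    using that by (auto simp: sum_list_replicate min_def not_le)
  then have "?thesis \<longleftrightarrow> ((\<forall>j\<le>n. \<forall>a<n. \<forall>b<n. j \<le> b \<longrightarrow> a < j \<longrightarrow> A $$ (a, b) = 0)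
      \<longleftrightarrow> (\<forall>a<n. \<forall>b<n. a < b \<longrightarrow> A $$ (a, b) = 0))" by simp
  moreover have "(\<forall>j\<le>n. \<forall>a<n. \<forall>b<n. j \<le> b \<longrightarrow> a < j \<longrightarrow> A $$ (a, b) = 0)
      \<longleftrightarrow> (\<forall>a<n. \<forall>b<n. a < b \<longrightarrow> A $$ (a, b) = 0)" (is "?l \<longleftrightarrow> ?r")
  proof
    assume l: ?l
    show ?r
    proof (intro allI impI)
      fix a b assume "a < n" "b < n" "a < b"
      then show "A $$ (a, b) = 0" using l[rule_format, of b a b] by simp
    qed
  qed auto
  ultimately show ?thesis by simp
qed

lemma preserves_left_flags_iff:
  assumes A: "A \<in> carrier_mat n n"
  shows "(\<forall>i\<le>length p. \<forall>v\<in>left_flag n p i. A *\<^sub>v v \<in> left_flag n p i)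
    \<longleftrightarrow> (\<forall>i\<le>length p. \<forall>a<n. \<forall>b<n. b < sum_list (take i p) \<longrightarrow> sum_list (take i p) \<le> a \<longrightarrow> A $$ (a, b) = 0)"
  unfolding left_flag_def preserves_coordinate_span_iff[OF A finite_atLeastLessThan]
  by (auto simp: not_less)

text \<open>The right flags, one for each index, make the matrices lower triangular; the left flags remove
the entries that connect different blocks. The number of orbits of the reversal of a block of size
\<open>k\<close> is \<open>\<lceil>k / 2\<rceil>\<close>.\<close>

lemma ind_ones_eq:
  assumes p: "sum_list p = n" and n: "0 < n"
  shows "ind_ones n p = (\<Sum>k\<leftarrow>p. (k + 1) div 2) - 1"
proof -
  interpret br: block_reversal n "block_of p" "block_rev p"
    using block_reversal_list[of p] p by simp
  have mem: "A \<in> seaweed_set n p (replicate n 1) \<longleftrightarrow> entries n A \<in> br.traceless" if A: "A \<in> carrier_mat n n" for A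
  proof -
    have "(\<forall>i\<le>length p. \<forall>a<n. \<forall>b<n. b < sum_list (take i p) \<longrightarrow> sum_list (take i p) \<le> a \<longrightarrow> A $$ (a, b) = 0) \<and>
        (\<forall>a<n. \<forall>b<n. a < b \<longrightarrow> A $$ (a, b) = 0)
      \<longleftrightarrow> (\<forall>a<n. \<forall>b<n. \<not> (b \<le> a \<and> block_of p a = block_of p b) \<longrightarrow> A $$ (a, b) = 0)" (is "?l \<longleftrightarrow> ?r")
    proof
      assume l: ?l
      show ?r
      proof (intro allI impI)
        fix a b assume ab: "a < n" "b < n" "\<not> (b \<le> a \<and> block_of p a = block_of p b)"
        show "A $$ (a, b) = 0"
        proof (cases "b \<le> a")
          case True
          then obtain i where "i \<le> length p" "b < sum_list (take i p)" "sum_list (take i p) \<le> a"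
            using ab block_of_eq_iff[of b a p] p by auto
          then show ?thesis using l ab by blast
        next
          case False
          then show ?thesis using l ab by simp
        qed
      qed
    next
      assume r: ?r
      have "A $$ (a, b) = 0"
        if "i \<le> length p" "a < n" "b < n" "b < sum_list (take i p)" "sum_list (take i p) \<le> a" for i a b
      proof -
        have "block_of p a \<noteq> block_of p b" using block_of_eq_iff[of b a p] p that by auto
        then show ?thesis using r that by simp
      qed
      then show ?l using r by auto
    qed
    also have "?r \<longleftrightarrow> entries n A \<in> supported br.positions"
      by (auto simp: supported_def entries_def br.positions_def)
    finally show ?thesis
      unfolding seaweed_set_def br.traceless_def
      using A preserves_left_flags_iff[OF A, of p] preserves_right_flags_iff[OF A]
      by (simp add: mat_trace_entries del: length_replicate) blast
  qed
  have "seaweed_set n p (replicate n 1) = {A \<in> carrier_mat n n. entries n A \<in> br.traceless}"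
    using mem seaweed_set_closed(1)[of n p "replicate n 1"] by blast
  then have alg: "seaweed n p (replicate n 1) = br.block_algebra"
    by (simp add: seaweed_def br.block_algebra_def)
  have "lie_index br.block_algebra commutator = card br.reps - 1"
  proof (rule br.lie_index_block_algebra[OF n])
    fix A B assume "A \<in> carrier br.block_algebra" "B \<in> carrier br.block_algebra"
    then show "commutator A B \<in> carrier br.block_algebra"
      using seaweed_set_closed(5)[of A n p "replicate n 1" B]
      unfolding alg[symmetric] by (simp add: seaweed_def)
  qed
  moreover have "card br.reps = (\<Sum>k\<leftarrow>p. (k + 1) div 2)"
    using card_block_rev_orbits[of p] p by (simp add: br.reps_def)
  ultimately show ?thesis unfolding ind_ones_def alg by simp
qed

section \<open>Partitions by half weight\<close>

text \<open>By the formula for the index, this is \<open>n - 1 - ind_ones n p\<close> for a partition \<open>p\<close> of \<open>n \<ge> 1\<close>.\<close>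

definition half_weight :: "nat list \<Rightarrow> nat" where
  "half_weight p = (\<Sum>k\<leftarrow>p. k div 2)"

lemma half_weight_simps [simp]:
  "half_weight [] = 0" "half_weight (k # p) = k div 2 + half_weight p"
  "half_weight (p @ q) = half_weight p + half_weight q"
  by (simp_all add: half_weight_def)

text \<open>What remains of a partition when its parts \<open>1\<close> are removed. The bound \<open>M\<close> on the parts allows
the generating function to be built up one part size at a time.\<close>

definition core_partitions :: "nat \<Rightarrow> nat \<Rightarrow> nat list set" where
  "core_partitions M j = {p. sorted_wrt (\<ge>) p \<and> set p \<subseteq> {2..M} \<and> half_weight p = j}"

lemma sum_list_le_half_weight: "sum_list p \<le> 3 * half_weight p" if "\<forall>k\<in>set p. 2 \<le> k"
  using that by (induction p) auto

text \<open>So at half weight \<open>j\<close> the bound \<open>M = 2 j + 1\<close> on the parts is no restriction.\<close>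

lemma part_le_half_weight: "k \<in> set p \<Longrightarrow> k \<le> 2 * half_weight p + 1"
  by (induction p) auto

lemma core_partitions_bound: "core_partitions M j = core_partitions (2 * j + 1) j" if "2 * j + 1 \<le> M"
proof -
  have "set p \<subseteq> {2..M} \<longleftrightarrow> set p \<subseteq> {2..2 * j + 1}" if "half_weight p = j" for p
    using \<open>2 * j + 1 \<le> M\<close> part_le_half_weight[of _ p] that by force
  then show ?thesis unfolding core_partitions_def by blast
qed

lemma finite_core_partitions: "finite (core_partitions M j)"
proof (rule finite_subset)
  show "core_partitions M j \<subseteq> {p. set p \<subseteq> {0..M} \<and> length p \<le> j}"
  proof
    fix p assume p: "p \<in> core_partitions M j"
    then have "\<forall>k\<in>set p. 2 \<le> k" by (auto simp: core_partitions_def)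
    then have "length p \<le> half_weight p" by (induction p) auto
    then show "p \<in> {p. set p \<subseteq> {0..M} \<and> length p \<le> j}"
      using p by (auto simp: core_partitions_def)
  qed
qed (simp add: finite_lists_length_le)

text \<open>A partition with parts at most \<open>Suc M\<close> either avoids \<open>Suc M\<close> or has it as first part, which can
then be removed.\<close>

lemma core_partitions_Suc:
  assumes "1 \<le> M"
  shows "core_partitions (Suc M) j = core_partitions M j \<union>
    (if Suc M div 2 \<le> j then (#) (Suc M) ` core_partitions (Suc M) (j - Suc M div 2) else {})"
    (is "?L = ?R")
proof (intro equalityI subsetI)
  fix p assume p: "p \<in> ?L"
  show "p \<in> ?R"
  proof (cases "Suc M \<in> set p")
    case True
    then obtain k q where q: "p = k # q" by (cases p) auto
    have "k = Suc M" using p True q by (force simp: core_partitions_def)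
    then show ?thesis using p q by (auto simp: core_partitions_def)
  next
    case False
    then have "set p \<subseteq> {2..M}" using p by (force simp: core_partitions_def le_Suc_eq)
    then show ?thesis using p by (auto simp: core_partitions_def)
  qed
next
  fix p assume "p \<in> ?R"
  then show "p \<in> ?L" using assms by (auto simp: core_partitions_def subset_iff split: if_splits)
qed

definition core_fps :: "nat \<Rightarrow> rat fps" where
  "core_fps M = Abs_fps (\<lambda>j. of_nat (card (core_partitions M j)))"

lemma core_fps_Suc:
  assumes "1 \<le> M"
  shows "core_fps (Suc M) * (1 - fps_X ^ (Suc M div 2)) = core_fps M"
proof (rule fps_ext)
  fix j
  let ?w = "Suc M div 2"
  have "card (core_partitions (Suc M) j) = card (core_partitions M j)
      + (if ?w \<le> j then card (core_partitions (Suc M) (j - ?w)) else 0)"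
    unfolding core_partitions_Suc[OF assms, of j]
    by (subst card_Un_disjoint)
       (auto simp: finite_core_partitions card_image, auto simp: core_partitions_def)
  then show "fps_nth (core_fps (Suc M) * (1 - fps_X ^ ?w)) j = fps_nth (core_fps M) j"
    by (auto simp: core_fps_def right_diff_distrib fps_X_power_mult_right_nth not_less)
qed

lemma core_fps_1: "core_fps 1 = 1"
proof (rule fps_ext)
  fix j
  have "core_partitions 1 j = (if j = 0 then {[]} else {})"
    by (auto simp: core_partitions_def)
  then show "fps_nth (core_fps 1) j = fps_nth 1 j" by (simp add: core_fps_def)
qed

text \<open>The parts \<open>2 m + 2\<close> and \<open>2 m + 3\<close> both have weight \<open>Suc m\<close>, which accounts for the square.\<close>

lemma core_fps_eq_prod: "core_fps (2 * N + 1) = (\<Prod>m<N. 1 / (1 - fps_X ^ Suc m) ^ 2)"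
proof (induction N)
  case 0
  show ?case using core_fps_1 by simp
next
  case (Suc N)
  let ?d = "1 - fps_X ^ Suc N :: rat fps"
    have "core_fps (2 * Suc N + 1) * ?d ^ 2 = core_fps (2 * N + 1)"
    using core_fps_Suc[of "2 * N + 2"] core_fps_Suc[of "2 * N + 1"]
    by (simp add: power2_eq_square mult.assoc[symmetric])
  note core = this
  have unit: "?d ^ 2 * (1 / ?d ^ 2) = 1"
    by (simp add: fps_divide_unit inverse_mult_eq_1')
  have "core_fps (2 * Suc N + 1) = core_fps (2 * Suc N + 1) * ?d ^ 2 * (1 / ?d ^ 2)"
    unfolding mult.assoc unit by (rule mult_1_right[symmetric])
  also have "\<dots> = core_fps (2 * N + 1) * (1 / ?d ^ 2)" unfolding core ..
  finally have "core_fps (2 * Suc N + 1) = core_fps (2 * N + 1) * (1 / ?d ^ 2)" .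
  then show ?case using Suc.IH by simp
qed

text \<open>The partial product up to \<open>N\<close> counts the partitions with parts at most \<open>2 N + 3\<close>, and this bound
does not affect the coefficients up to \<open>N\<close>.\<close>

lemma core_fps_has_prod:
  "(\<lambda>m. 1 / (1 - fps_X ^ Suc m) ^ 2) has_prod
    Abs_fps (\<lambda>j. of_nat (card (core_partitions (2 * j + 1) j)) :: rat)"
    (is "?f has_prod ?G")
proof -
  have "(\<lambda>N. \<Prod>m\<le>N. ?f m) \<longlonglongrightarrow> ?G"
  proof (rule tendsto_fpsI)
    fix j
    show "\<forall>\<^sub>F N in sequentially. fps_nth (\<Prod>m\<le>N. ?f m) j = fps_nth ?G j"
      using eventually_ge_at_top[of j]
    proof eventually_elim
      case (elim N)
      have "(\<Prod>m\<le>N. ?f m) = core_fps (2 * Suc N + 1)"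
        unfolding core_fps_eq_prod lessThan_Suc_atMost ..
      then show ?case using elim core_partitions_bound[of j "2 * Suc N + 1"]
        by (simp add: core_fps_def)
    qed
  qed
  moreover have "core_partitions 1 0 = {[]}" by (auto simp: core_partitions_def)
  then have "fps_nth ?G 0 \<noteq> 0" by simp
  then have "?G \<noteq> 0" by (metis fps_zero_nth)
  ultimately show ?thesis by (simp add: has_prod_def raw_has_prod_def)
qed

text \<open>Deleting the parts \<open>1\<close> is inverse to filling up with parts \<open>1\<close> to the sum \<open>n\<close>. The latter is
possible because the remaining parts \<open>k \<ge> 2\<close> satisfy \<open>k \<le> 3 \<lfloor>k / 2\<rfloor>\<close>.\<close>

lemma card_partitions_half_weight:
  assumes "3 * j \<le> n"
  shows "card {p \<in> integer_partitions n. half_weight p = j} = card (core_partitions (2 * j + 1) j)"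
    (is "card ?A = card ?B")
proof -
  define pad where "pad p = p @ replicate (n - sum_list p) 1" for p :: "nat list"
  have sum_le: "sum_list p \<le> n" if "p \<in> ?B" for p
    using that sum_list_le_half_weight[of p] assms by (force simp: core_partitions_def)
  have "bij_betw pad ?B ?A"
  proof (rule bij_betwI[where g = "filter (\<lambda>k. 2 \<le> k)"])
    show "pad \<in> ?B \<rightarrow> ?A"
    proof
      fix p assume p: "p \<in> ?B"
      have "half_weight (replicate m 1) = 0" for m by (induction m) auto
      moreover have "sorted_wrt (\<ge>) (replicate m (1::nat))" for m by (induction m) auto
      ultimately show "pad p \<in> ?A"
        using p sum_le[OF p] unfolding core_partitions_def integer_partitions_def pad_def
        by (auto simp: sorted_wrt_append sum_list_replicate)
    qed
    have hw: "half_weight (filter (\<lambda>k. 2 \<le> k) p) = half_weight p" for p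
      by (induction p) auto
    show "filter (\<lambda>k. 2 \<le> k) \<in> ?A \<rightarrow> ?B"
    proof
      fix p assume p: "p \<in> ?A"
      then have "\<forall>k\<in>set p. k \<le> 2 * j + 1" using part_le_half_weight by auto
      then show "filter (\<lambda>k. 2 \<le> k) p \<in> ?B"
        using p hw[of p] unfolding core_partitions_def integer_partitions_def
        by (auto intro: sorted_wrt_filter)
    qed
    fix p
    show "filter (\<lambda>k. 2 \<le> k) (pad p) = p" if "p \<in> ?B"
      using that by (auto simp: pad_def core_partitions_def filter_id_conv)
    have "p = filter (\<lambda>k. 2 \<le> k) p @ replicate (sum_list p - sum_list (filter (\<lambda>k. 2 \<le> k) p)) 1"
      if "sorted_wrt (\<ge>) p" "\<forall>k\<in>set p. 0 < k" for p :: "nat list"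
      using that
    proof (induction p)
      case (Cons k p)
      show ?case
      proof (cases "2 \<le> k")
        case False
        have "\<forall>l\<in>set (k # p). l = 1" using Cons.prems False by force
        then obtain m where m: "k # p = replicate m 1" by (metis replicate_eqI)
        show ?thesis unfolding m by (simp add: sum_list_replicate)
      qed (use Cons in auto)
    qed simp
    then show "pad (filter (\<lambda>k. 2 \<le> k) p) = p" if "p \<in> ?A"
      using that by (auto simp: pad_def integer_partitions_def)
  qed
  then show ?thesis by (simp add: bij_betw_same_card)
qed

section \<open>The generating function of the eventual counts\<close>

lemma index_eq_iff_half_weight:
  assumes p: "p \<in> integer_partitions n" and n: "0 < n" and i: "1 \<le> i"
  shows "int (ind_ones n p) = int n - int i \<longleftrightarrow> half_weight p = i - 1"
proof -
  have s: "sum_list p = n" using p by (simp add: integer_partitions_def)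
  have "half_weight p + (\<Sum>k\<leftarrow>p. (k + 1) div 2) = sum_list p"
    by (induction p) auto
  moreover have "0 < (\<Sum>k\<leftarrow>p. (k + 1) div 2)"
  proof (cases p)
    case (Cons k q)
    then show ?thesis using p by (auto simp: integer_partitions_def)
  qed (use s n in simp)
  ultimately show ?thesis using ind_ones_eq[OF s n] s i by linarith
qed

lemma index_count_eventually:
  assumes "1 \<le> i"
  shows "eventually (\<lambda>n. index_count i n = card (core_partitions (2 * (i - 1) + 1) (i - 1))) sequentially"
  using eventually_ge_at_top[of "Suc (3 * (i - 1))"]
proof eventually_elim
  case (elim n)
  have "{p \<in> integer_partitions n. int (ind_ones n p) = int n - int i} =
      {p \<in> integer_partitions n. half_weight p = i - 1}"
    using index_eq_iff_half_weight[OF _ _ assms] elim by auto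
  then show ?case using card_partitions_half_weight[of "i - 1" n] elim by (simp add: index_count_def)
qed

theorem theorem12:
  shows "(\<forall>i\<ge>1. \<exists>c. eventually (\<lambda>n. index_count i n = c) sequentially) \<and>
    (\<lambda>m. 1 / (1 - fps_X ^ Suc m) ^ 2) has_prod
      Abs_fps (\<lambda>k. of_nat (eventual_value (index_count (Suc k))) :: rat)"
proof
  show "\<forall>i\<ge>1. \<exists>c. eventually (\<lambda>n. index_count i n = c) sequentially"
    using index_count_eventually by blast
  have "eventual_value (index_count (Suc k)) = card (core_partitions (2 * k + 1) k)" for k
    using eventual_valueI[OF index_count_eventually[of "Suc k"]] by simp
  then show "(\<lambda>m. 1 / (1 - fps_X ^ Suc m) ^ 2) has_prod
      Abs_fps (\<lambda>k. of_nat (eventual_value (index_count (Suc k))) :: rat)"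
    using core_fps_has_prod by simp
qed

end
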